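(* Let $m,n$ be positive integers. Then: (i) there exist margins $u\in\mathbb{R}^m_{>0}$, $v\in\mathbb{R}^n_{>0}$ (with $\sum_i u_i=\sum_j v_j$) such that the corresponding $m\times n$ transportation polytope $P$ has circuit diameter $\mathcal{CD}(P)\geq \min\{(m-1)(n-1),\,m+n-1\}$; (ii) every $m\times n$ transportation polytope $P$ satisfies $\mathcal{CD}_f(P)\leq m+n-1$; (iii) consequently, for all $m\geq 3$ and $n\geq 4$ there exists an $m\times n$ transportation polytope $P$ with $\mathcal{CD}(P)=\mathcal{CD}_f(P)=m+n-1$.
   Context: For $u\in\mathbb{R}^m_{>0}$, $v\in\mathbb{R}^n_{>0}$, the $m\times n$ transportation polytope is $P=\{y\in\mathbb{R}^{m\times n}: \sum_{j=1}^n y_{ij}=u_i\ (i\in[m]),\ \sum_{i=1}^m y_{ij}=v_j\ (j\in[n]),\ y\geq 0\}$; write it as $\{y: Ay=b,\ y\ge 0\}$. The circuits of $P$ are the nonzero vectors $g\in\ker(A)$ of minimal support (normalized to coprime integer entries); for transportation polytopes these are exactly the vectors obtained from a simple even cycle $(\mathfrak{s}_{i_1},\mathfrak{d}_{j_1},\mathfrak{s}_{i_2},\mathfrak{d}_{j_2},\ldots,\mathfrak{s}_{i_k},\mathfrak{d}_{j_k})$ in the complete bipartite graph $K_{m,n}$ (supply nodes $\mathfrak{s}_i$, demand nodes $\mathfrak{d}_j$, edge $\{\mathfrak{s}_i,\mathfrak{d}_j\}$ corresponding to coordinate $y_{ij}$) by putting $+1$ on the edges $\{\mathfrak{s}_{i_l},\mathfrak{d}_{j_l}\}$,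 $-1$ on the edges $\{\mathfrak{d}_{j_l},\mathfrak{s}_{i_{l+1}}\}$ (indices cyclic), and $0$ elsewhere. For vertices $w^{(1)},w^{(2)}$ of $P$, a circuit walk of length $k$ is a sequence $w^{(1)}=y^{(0)},\ldots,y^{(k)}=w^{(2)}$ with $y^{(i+1)}-y^{(i)}=\alpha_i g^i$ for circuits $g^i$ and $\alpha_i>0$ (intermediate points need not lie in $P$). The circuit distance $\mathcal{CD}$ is the minimum length of such a walk; $\mathcal{CD}_f$ is the minimum length of such a walk in which all $y^{(i)}$ lie in $P$. The corresponding diameters $\mathcal{CD}(P)$, $\mathcal{CD}_f(P)$ are the maxima of these distances over all pairs of vertices of $P$. *)

theory Defs
  imports "HOL-Analysis.Analysis" "HOL-Library.Extended_Nat"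
begin

text \<open>
  An \<open>m \<times> n\<close> array is an element \<open>y\<close> of \<^typ>\<open>real^'n^'m\<close> with entries \<open>y $ i $ j\<close>,
  where \<open>m = CARD('m)\<close> and \<open>n = CARD('n)\<close>. The map \<open>margins\<close> is the linear map \<open>y \<mapsto> A y\<close>
  of the standard form \<open>{y. A y = b \<and> y \<ge> 0}\<close>, with \<open>b = (u, v)\<close>.
\<close>

definition margins :: "real^'n^'m \<Rightarrow> (real^'m) \<times> (real^'n)" where
  "margins y = ((\<chi> i. \<Sum>j\<in>UNIV. y $ i $ j), (\<chi> j. \<Sum>i\<in>UNIV. y $ i $ j))"

definition transportation_polytope :: "real^'m \<Rightarrow> real^'n \<Rightarrow> (real^'n^'m) set" where
  "transportation_polytope u v = {y. margins y = (u, v) \<and> (\<forall>i j. 0 \<le> y $ i $ j)}"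

definition vertices :: "'a::real_vector set \<Rightarrow> 'a set" where
  "vertices P = {w. w extreme_point_of P}"

definition supp :: "real^'n^'m \<Rightarrow> ('m \<times> 'n) set" where
  "supp y = {(i, j). y $ i $ j \<noteq> 0}"

text \<open>The circuits depend only on the matrix \<open>A\<close>, hence only on \<open>m\<close> and \<open>n\<close>.\<close>

definition circuits :: "(real^'n^'m) set" where
  "circuits = {g. margins g = 0 \<and> g \<noteq> 0
     \<and> (\<forall>h. margins h = 0 \<and> h \<noteq> 0 \<longrightarrow> \<not> supp h \<subset> supp g)
     \<and> (\<exists>z :: int^'n^'m. (\<forall>i j. g $ i $ j = of_int (z $ i $ j))
                        \<and> Gcd {z $ i $ j | i j. True} = 1)}"

definition circuit_walk ::
    "nat \<Rightarrow> (nat \<Rightarrow> real^'n^'m) \<Rightarrow> real^'n^'m \<Rightarrow> real^'n^'m \<Rightarrow> bool" where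
  "circuit_walk k y w1 w2 \<longleftrightarrow> y 0 = w1 \<and> y k = w2
     \<and> (\<forall>i<k. \<exists>g\<in>circuits. \<exists>\<alpha>>0. y (Suc i) - y i = \<alpha> *\<^sub>R g)"

definition feasible_circuit_walk ::
    "(real^'n^'m) set \<Rightarrow> nat \<Rightarrow> (nat \<Rightarrow> real^'n^'m) \<Rightarrow> real^'n^'m \<Rightarrow> real^'n^'m \<Rightarrow> bool" where
  "feasible_circuit_walk P k y w1 w2 \<longleftrightarrow> circuit_walk k y w1 w2 \<and> (\<forall>i\<le>k. y i \<in> P)"

text \<open>
  Distances and diameters take values in \<^typ>\<open>enat\<close>: the distance is \<open>\<infinity>\<close> if there is no walk.
  A polytope has finitely many vertices, so the supremum in the diameters is a maximum
  (and is \<open>0\<close> for the empty polytope, which arises when the total supply and demand differ).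
\<close>

definition circuit_distance :: "real^'n^'m \<Rightarrow> real^'n^'m \<Rightarrow> enat" where
  "circuit_distance w1 w2 = Inf {enat k | k. \<exists>y. circuit_walk k y w1 w2}"

definition feasible_circuit_distance ::
    "(real^'n^'m) set \<Rightarrow> real^'n^'m \<Rightarrow> real^'n^'m \<Rightarrow> enat" where
  "feasible_circuit_distance P w1 w2 = Inf {enat k | k. \<exists>y. feasible_circuit_walk P k y w1 w2}"

definition circuit_diameter :: "(real^'n^'m) set \<Rightarrow> enat" where
  "circuit_diameter P = (SUP w1\<in>vertices P. SUP w2\<in>vertices P. circuit_distance w1 w2)"

definition feasible_circuit_diameter :: "(real^'n^'m) set \<Rightarrow> enat" where
  "feasible_circuit_diameter P =
     (SUP w1\<in>vertices P. SUP w2\<in>vertices P. feasible_circuit_distance P w1 w2)"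

end

theory Submission
  imports Defs
begin

text \<open>
  For vertices \<open>w\<^sub>1, w\<^sub>2\<close> let \<open>V\<close> be the space of kernel vectors supported on \<open>supp (w\<^sub>2 - w\<^sub>1)\<close>.

  Upper bound: a step along a circuit that is sign-compatible with the remaining difference, as long
  as possible, stays feasible and strictly decreases \<open>dim V\<close>. A vector of \<open>V\<close> vanishing on
  \<open>supp w\<^sub>2\<close> is supported on the forest \<open>supp w\<^sub>1\<close>, hence \<open>0\<close>; so \<open>dim V \<le> |supp w\<^sub>2| \<le> m + n - 1\<close>.

  Lower bound: fix two spanning trees \<open>T\<^sub>1, T\<^sub>2\<close> of \<open>K\<^sub>m\<^sub>,\<^sub>n\<close> that carry positive
  flows \<open>x, y\<close> with the same margins, with \<open>|T\<^sub>1 \<union> T\<^sub>2| = min (m n) (2 (m + n - 1))\<close>.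
  The kernel vectors supported on \<open>T\<^sub>1 \<union> T\<^sub>2\<close> form a space of dimension at least
  \<open>|T\<^sub>1 \<union> T\<^sub>2| - (m + n - 1) = min ((m - 1) (n - 1)) (m + n - 1)\<close>. A small generic
  perturbation of \<open>y - x\<close> in this space is again a difference of two vertices with supports
  \<open>T\<^sub>1, T\<^sub>2\<close>, and it avoids the finitely many spans of fewer circuits. Such pairs of
  trees arise from pairs for \<open>2 \<times> 2\<close>, \<open>3 \<times> 3\<close> and \<open>3 \<times> 4\<close> by attaching leaves.
\<close>

section \<open>Kernel vectors with prescribed support\<close>

text \<open>With all edges oriented from rows to columns, zero margins say that flow is conserved at
  every node. So this is the real cycle space of the subgraph of the complete bipartite graph with
  edge set \<open>S\<close>.\<close>

definition kernel_on :: "('m \<times> 'n) set \<Rightarrow> (real^'n^'m) set" where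
  "kernel_on S = {h. margins h = 0 \<and> supp h \<subseteq> S}"

lemma linear_margins: "linear margins"
  by (rule linearI)
     (auto simp: margins_def vec_eq_iff sum.distrib sum_distrib_left)

lemma margins_add: "margins (x + y) = margins x + margins y"
  by (rule linear_add[OF linear_margins])

lemma margins_diff: "margins (x - y) = margins x - margins y"
  by (rule linear_diff[OF linear_margins])

lemma margins_scaleR: "margins (c *\<^sub>R x) = c *\<^sub>R margins x"
  by (rule linear_scale[OF linear_margins])

lemma margins_eq_0_iff:
  "margins x = 0 \<longleftrightarrow>
     (\<forall>i. (\<Sum>j\<in>UNIV. x $ i $ j) = 0) \<and> (\<forall>j. (\<Sum>i\<in>UNIV. x $ i $ j) = 0)"
  by (simp add: margins_def vec_eq_iff zero_prod_def)

lemma in_supp_iff [simp]: "(i, j) \<in> supp y \<longleftrightarrow> y $ i $ j \<noteq> 0"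
  by (simp add: supp_def)

lemma supp_subset_iff: "supp y \<subseteq> S \<longleftrightarrow> (\<forall>i j. (i, j) \<notin> S \<longrightarrow> y $ i $ j = 0)"
  by (auto simp: supp_def)

lemma supp_eq_empty_iff: "supp y = {} \<longleftrightarrow> y = 0"
  by (auto simp: supp_def vec_eq_iff)

lemma subspace_supported: "subspace {y :: real^'n^'m. supp y \<subseteq> S}"
  by (auto simp: subspace_def supp_subset_iff)

lemma subspace_kernel_on: "subspace (kernel_on S)"
  by (auto simp: subspace_def kernel_on_def supp_subset_iff margins_add margins_scaleR
                 linear_0[OF linear_margins])

lemma kernel_on_mono: "S \<subseteq> T \<Longrightarrow> kernel_on S \<subseteq> kernel_on T"
  by (auto simp: kernel_on_def)

text \<open>The standard basis arrays indexed by \<open>S\<close> span this space. The work lies in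
  expressing the support condition through vanishing inner products, the form that
  \<open>dim_substandard\<close> expects.\<close>

lemma dim_supported: "dim {y :: real^'n^'m. supp y \<subseteq> S} = card S"
proof -
  let ?e = "\<lambda>(i, j). axis i (axis j 1) :: real^'n^'m"
  have inj: "inj ?e"
    by (auto simp: inj_def axis_eq_axis)
  have Basis: "Basis = range ?e"
    by (auto simp: Basis_vec_def)
  have eq: "{y :: real^'n^'m. supp y \<subseteq> S} = {y. \<forall>b\<in>Basis. b \<notin> ?e ` S \<longrightarrow> y \<bullet> b = 0}"
  proof -
    have "supp y \<subseteq> S \<longleftrightarrow> (\<forall>b\<in>Basis. b \<notin> ?e ` S \<longrightarrow> y \<bullet> b = 0)" for y :: "real^'n^'m"
    proof -
      have "(\<forall>b\<in>range ?e. b \<notin> ?e ` S \<longrightarrow> y \<bullet> b = 0) \<longleftrightarrow> (\<forall>p. ?e p \<notin> ?e ` S \<longrightarrow> y \<bullet> ?e p = 0)"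
        by blast
      also have "\<dots> \<longleftrightarrow> (\<forall>p. p \<notin> S \<longrightarrow> y \<bullet> ?e p = 0)"
        unfolding inj_image_mem_iff[OF inj] ..
      also have "\<dots> \<longleftrightarrow> supp y \<subseteq> S"
        by (auto simp: supp_subset_iff inner_axis)
      finally show ?thesis
        by (simp only: Basis)
    qed
    then show ?thesis by simp
  qed
  have "?e ` S \<subseteq> Basis"
    by (auto simp: Basis_vec_def)
  then show ?thesis
    unfolding eq using inj by (simp add: dim_substandard card_image inj_on_subset)
qed

text \<open>Half of rank-nullity for \<open>f\<close> restricted to \<open>W\<close>: preimages in
  \<open>W\<close> of a basis of the image, joined with a basis of the kernel, span
  \<open>W\<close>.\<close>

lemma dim_le_image_plus_kernel:
  fixes f :: "'a::euclidean_space \<Rightarrow> 'b::euclidean_space"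
  assumes f: "linear f" and W: "subspace W"
  shows "dim W \<le> dim (f ` W) + dim {x \<in> W. f x = 0}"
proof -
  obtain B where B: "B \<subseteq> f ` W" "independent B" "f ` W \<subseteq> span B" "card B = dim (f ` W)"
    using basis_exists[of "f ` W"] by metis
  obtain C where C: "C \<subseteq> W" "inj_on f C" "B = f ` C"
    using iffD1[OF subset_image_inj B(1)] by (elim exE conjE)
  define N where "N = {x \<in> W. f x = 0}"
  obtain K where K: "K \<subseteq> N" "independent K" "N \<subseteq> span K" "card K = dim N"
    using basis_exists[of N] by metis
  have "finite B" "finite K"
    using independent_imp_finite[OF B(2)] independent_imp_finite[OF K(2)] .
  then have "finite C"
    using finite_imageD[of f C] C(2,3) by simp
  have "W \<subseteq> span (C \<union> K)"
  proof
    fix x assume x: "x \<in> W"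
    then have "f x \<in> span (f ` C)"
      using B(3) C(3) by blast
    then obtain y where y: "y \<in> span C" "f x = f y"
      unfolding linear_span_image[OF f] by (rule imageE)
    have "y \<in> W"
      using span_minimal[OF C(1) W] y(1) by blast
    then have "x - y \<in> N"
      using x y(2) W by (simp add: N_def linear_diff[OF f] subspace_diff)
    then have "x - y \<in> span (C \<union> K)"
      using K(3) span_mono[of K "C \<union> K"] by blast
    moreover have "y \<in> span (C \<union> K)"
      using y(1) span_mono[of C "C \<union> K"] by blast
    ultimately have "(x - y) + y \<in> span (C \<union> K)"
      by (rule span_add)
    then show "x \<in> span (C \<union> K)" by simp
  qed
  then have "dim W \<le> card (C \<union> K)"
    using \<open>finite C\<close> \<open>finite K\<close> by (intro dim_le_card) auto
  also have "\<dots> \<le> card C + card K"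
    by (rule card_Un_le)
  finally show ?thesis
    using B(4) K(4) card_image[OF C(2)] C(3) by (simp add: N_def)
qed

text \<open>The row sums and the column sums of an array have the same total, so all margins lie in
  the hyperplane orthogonal to \<open>(1, -1)\<close>. This accounts for the
  \<open>- 1\<close>.\<close>

lemma dim_margins_image_le:
  fixes W :: "(real^'n^'m) set"
  shows "dim (margins ` W) \<le> CARD('m) + CARD('n) - 1"
proof -
  let ?a = "(1, -1) :: (real^'m) \<times> (real^'n)"
  have "?a \<bullet> margins y = 0" for y :: "real^'n^'m"
    using sum.swap[of "\<lambda>i j. y $ i $ j" UNIV UNIV]
    by (simp add: margins_def inner_vec_def sum_negf)
  then have "margins ` W \<subseteq> {z. ?a \<bullet> z = 0}"
    by auto
  then have "dim (margins ` W) \<le> dim {z. ?a \<bullet> z = 0}"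
    by (rule dim_subset)
  also have "\<dots> = CARD('m) + CARD('n) - 1"
    by (subst dim_hyperplane) (auto simp: zero_prod_def)
  finally show ?thesis .
qed

text \<open>Rank-nullity for \<open>margins\<close> on the arrays supported on \<open>S\<close>.
  With a trivial kernel it bounds the size of a forest; for the union of two trees it forces a large
  kernel.\<close>

lemma card_le_dim_kernel_on:
  fixes S :: "('m::finite \<times> 'n::finite) set"
  shows "card S \<le> CARD('m) + CARD('n) - 1 + dim (kernel_on S)"
proof -
  let ?W = "{y :: real^'n^'m. supp y \<subseteq> S}"
  have "kernel_on S = {x \<in> ?W. margins x = 0}"
    by (auto simp: kernel_on_def)
  then show ?thesis
    using dim_le_image_plus_kernel[OF linear_margins subspace_supported[of S]]
      dim_margins_image_le[of ?W]
    by (simp add: dim_supported)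
qed

text \<open>Graph-theoretically, a cycle-free edge set of \<open>K\<^sub>m\<^sub>,\<^sub>n\<close>.\<close>

definition forest :: "('m::finite \<times> 'n::finite) set \<Rightarrow> bool" where
  "forest T \<longleftrightarrow> kernel_on T = {0}"

lemma forestD: "forest T \<Longrightarrow> margins h = 0 \<Longrightarrow> supp h \<subseteq> T \<Longrightarrow> h = 0"
  by (auto simp: forest_def kernel_on_def)

lemma forestI:
  assumes "\<And>h. margins h = 0 \<Longrightarrow> supp h \<subseteq> T \<Longrightarrow> h = 0"
  shows "forest T"
  using assms subspace_0[OF subspace_kernel_on[of T]] by (auto simp: forest_def kernel_on_def)

lemma card_forest_le:
  fixes T :: "('m::finite \<times> 'n::finite) set"
  assumes "forest T"
  shows "card T \<le> CARD('m) + CARD('n) - 1"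
  using card_le_dim_kernel_on[of T] assms by (simp add: forest_def)

text \<open>Restriction to the coordinates in \<open>supp w2\<close> is injective on this space:
  whatever it kills is supported on \<open>supp (w2 - w1)\<close> outside \<open>supp w2\<close>,
  hence on the forest \<open>supp w1\<close>.\<close>

lemma dim_kernel_on_diff_le:
  fixes w1 w2 :: "real^'n^'m"
  assumes "forest (supp w1)"
  shows "dim (kernel_on (supp (w2 - w1))) \<le> card (supp w2)"
proof -
  let ?V = "kernel_on (supp (w2 - w1))"
  let ?f = "\<lambda>y :: real^'n^'m. (\<chi> i j. if w2 $ i $ j \<noteq> 0 then y $ i $ j else 0) :: real^'n^'m"
  have lin: "linear ?f"
    by (rule linearI) (auto simp: vec_eq_iff)
  have "y = 0" if "y \<in> ?V" "?f y = 0" for y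
  proof (rule forestD[OF assms])
    show "margins y = 0"
      using that by (simp add: kernel_on_def)
    show "supp y \<subseteq> supp w1"
      using that by (simp add: kernel_on_def supp_subset_iff vec_eq_iff) metis
  qed
  then have "{y \<in> ?V. ?f y = 0} \<subseteq> {0}"
    by blast
  then have "dim {y \<in> ?V. ?f y = 0} = 0"
    by (simp add: dim_eq_0)
  moreover have "dim (?f ` ?V) \<le> dim {y :: real^'n^'m. supp y \<subseteq> supp w2}"
    by (rule dim_subset) (auto simp: supp_subset_iff)
  ultimately show ?thesis
    using dim_le_image_plus_kernel[OF lin subspace_kernel_on[of "supp (w2 - w1)"]]
    unfolding dim_supported by linarith
qed

section \<open>Vertices\<close>

text \<open>If \<open>w\<close> lies strictly between two points of the polytope, nonnegativity
  makes both vanish wherever \<open>w\<close> does, so their difference is a kernel vector on a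
  forest.\<close>

lemma vertex_if_forest:
  assumes w: "w \<in> transportation_polytope u v" and "forest (supp w)"
  shows "w \<in> vertices (transportation_polytope u v)"
proof -
  have False if ab: "a \<in> transportation_polytope u v" "b \<in> transportation_polytope u v"
    "w \<in> open_segment a b" for a b
  proof -
    obtain t where t: "0 < t" "t < 1" and wt: "w = (1 - t) *\<^sub>R a + t *\<^sub>R b" and ne: "a \<noteq> b"
      using ab(3) by (auto simp: in_segment)
    have zero: "a $ i $ j = 0 \<and> b $ i $ j = 0" if "w $ i $ j = 0" for i j
    proof -
      have "0 \<le> (1 - t) * a $ i $ j" "0 \<le> t * b $ i $ j"
        using ab t by (auto simp: transportation_polytope_def)
      moreover have "(1 - t) * a $ i $ j + t * b $ i $ j = 0"
        using that wt by simp
      ultimately have "(1 - t) * a $ i $ j = 0" "t * b $ i $ j = 0"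
        by linarith+
      then show ?thesis using t by auto
    qed
    have "a - b = 0"
    proof (rule forestD[OF \<open>forest (supp w)\<close>])
      show "margins (a - b) = 0"
        using ab by (simp add: margins_diff transportation_polytope_def)
      show "supp (a - b) \<subseteq> supp w"
        using zero by (auto simp: supp_subset_iff)
    qed
    with ne show False by simp
  qed
  with w show ?thesis
    unfolding vertices_def extreme_point_of_def by blast
qed

text \<open>A nonzero kernel vector on \<open>supp w\<close> could be added and subtracted with a
  small factor, which would make \<open>w\<close> the midpoint of a segment in the polytope.\<close>

lemma forest_if_vertex:
  assumes "w \<in> vertices (transportation_polytope u v)"
  shows "forest (supp w)"
proof (rule forestI)
  fix h assume h: "margins h = 0" "supp h \<subseteq> supp w"
  let ?P = "transportation_polytope u v"
  have w: "w \<in> ?P" and ext: "\<And>a b. a \<in> ?P \<Longrightarrow> b \<in> ?P \<Longrightarrow> w \<notin> open_segment a b"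
    using assms by (auto simp: vertices_def extreme_point_of_def)
  show "h = 0"
  proof (rule ccontr)
    assume "h \<noteq> 0"
    \<comment> \<open>On \<open>supp w\<close> there is room because \<open>w\<close> is strictly
      positive there; elsewhere \<open>h\<close> vanishes. The filter \<open>at_right 0\<close>
      merges these finitely many smallness conditions.\<close>
    have "\<forall>\<^sub>F t in at_right 0. \<bar>t * h $ i $ j\<bar> \<le> w $ i $ j" for i j
    proof (cases "w $ i $ j = 0")
      case True
      then show ?thesis using h(2) by (auto simp: supp_subset_iff)
    next
      case False
      then have pos: "0 < w $ i $ j"
        using w by (auto simp: transportation_polytope_def less_le)
      have "((\<lambda>t. \<bar>t * h $ i $ j\<bar>) \<longlongrightarrow> \<bar>0 * h $ i $ j\<bar>) (at_right 0)"
        by (intro tendsto_intros)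
      then have "\<forall>\<^sub>F t in at_right 0. \<bar>t * h $ i $ j\<bar> < w $ i $ j"
        using pos by (intro order_tendstoD(2)) auto
      then show ?thesis by eventually_elim simp
    qed
    then have "\<forall>\<^sub>F t in at_right 0. \<forall>i j. \<bar>t * h $ i $ j\<bar> \<le> w $ i $ j"
      by (intro eventually_all_finite) auto
    moreover have "\<forall>\<^sub>F t in at_right (0::real). 0 < t"
      by (rule eventually_at_right_less)
    ultimately have "\<forall>\<^sub>F t in at_right 0. 0 < t \<and> (\<forall>i j. \<bar>t * h $ i $ j\<bar> \<le> w $ i $ j)"
      by eventually_elim simp
    then obtain t where t: "0 < t" and le: "\<And>i j. \<bar>t * h $ i $ j\<bar> \<le> w $ i $ j"
      by (auto dest!: eventually_happens)
    have "w - t *\<^sub>R h \<in> ?P" "w + t *\<^sub>R h \<in> ?P"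
    proof -
      have "0 \<le> w $ i $ j - t * h $ i $ j" "0 \<le> w $ i $ j + t * h $ i $ j" for i j
        using le[of i j] by linarith+
      then show "w - t *\<^sub>R h \<in> ?P" "w + t *\<^sub>R h \<in> ?P"
        using w h(1) by (simp_all add: transportation_polytope_def margins_diff margins_add
            margins_scaleR)
    qed
    moreover have "w \<in> open_segment (w - t *\<^sub>R h) (w + t *\<^sub>R h)"
      unfolding in_segment
    proof (intro conjI exI[of _ "1/2"])
      show "w - t *\<^sub>R h \<noteq> w + t *\<^sub>R h"
        using t \<open>h \<noteq> 0\<close> by (auto simp: vec_eq_iff)
      show "w = (1 - 1 / 2) *\<^sub>R (w - t *\<^sub>R h) + (1 / 2) *\<^sub>R (w + t *\<^sub>R h)"
        by (simp add: vec_eq_iff field_simps)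
    qed auto
    ultimately show False using ext by blast
  qed
qed

section \<open>Conformal circuits and the upper bound\<close>

text \<open>A nonempty subset of least cardinality among those mapped into themselves is permuted by
  \<open>f\<close>, since its image is another such subset. This replaces following an orbit until
  it closes up.\<close>

lemma minimal_invariant_subset:
  assumes "finite X" "X \<noteq> {}" "f ` X \<subseteq> X"
  obtains Y where "Y \<subseteq> X" "Y \<noteq> {}" "f ` Y = Y" "inj_on f Y"
proof -
  let ?P = "\<lambda>Y. Y \<subseteq> X \<and> Y \<noteq> {} \<and> f ` Y \<subseteq> Y"
  have "?P X" using assms by simp
  then obtain Y where Y: "?P Y" and min: "\<And>Z. ?P Z \<Longrightarrow> card Y \<le> card Z"
    using ex_has_least_nat[of ?P X card] by blast
  have fin: "finite Y"
    using Y assms(1) finite_subset by blast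
  have "?P (f ` Y)"
    using Y by blast
  then have "card Y \<le> card (f ` Y)"
    by (rule min)
  then have eq: "f ` Y = Y"
    using Y fin by (meson card_seteq)
  then have "inj_on f Y"
    using fin by (simp add: eq_card_imp_inj_on)
  with Y eq that show ?thesis by blast
qed

lemma sum_pos_if_sum_eq_0:
  fixes f :: "'a::finite \<Rightarrow> real"
  assumes "(\<Sum>a\<in>UNIV. f a) = 0" "f a \<noteq> 0"
  shows "\<exists>b. 0 < f b" "\<exists>b. f b < 0"
proof -
  show "\<exists>b. 0 < f b"
  proof (rule ccontr)
    assume "\<nexists>b. 0 < f b"
    then have "\<And>b. f b \<le> 0" by (meson not_less)
    then show False using assms sum_nonneg_eq_0_iff[of UNIV "\<lambda>a. - f a"]
      by (simp add: sum_negf)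
  qed
  show "\<exists>b. f b < 0"
  proof (rule ccontr)
    assume "\<nexists>b. f b < 0"
    then have "\<And>b. 0 \<le> f b" by (meson not_less)
    then show False using assms sum_nonneg_eq_0_iff[of UNIV f] by simp
  qed
qed

text \<open>
  Alternately following a positive entry in a row and a negative entry in a column
  defines a self-map of the rows; an orbit of it is an alternating cycle.
\<close>

lemma conformal_cycle:
  fixes d :: "real^'n^'m"
  assumes d: "margins d = 0" "d \<noteq> 0"
  obtains c :: "real^'n^'m"
  where "margins c = 0" "c \<noteq> 0" "\<And>i j. c $ i $ j \<in> {0, sgn (d $ i $ j)}"
proof -
  have row: "(\<Sum>j\<in>UNIV. d $ i $ j) = 0" and col: "(\<Sum>i\<in>UNIV. d $ i $ j) = 0" for i j
    using d(1) by (simp_all add: margins_eq_0_iff)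
  \<comment> \<open>Row sums are zero, so every nonzero row has a positive entry and belongs to
    \<open>X\<close>. Hence a row reached through a negative entry is again in \<open>X\<close>, and
    the walk can continue.\<close>
  define X where "X = {i. \<exists>j. 0 < d $ i $ j}"
  have row_X: "i \<in> X" if "d $ i $ j \<noteq> 0" for i j
    using sum_pos_if_sum_eq_0(1)[OF row that] by (simp add: X_def)
  obtain i0 j0 where "d $ i0 $ j0 \<noteq> 0"
    using d(2) by (auto simp: vec_eq_iff)
  then have "X \<noteq> {}" using row_X by blast
  have "\<forall>i. \<exists>j. i \<in> X \<longrightarrow> 0 < d $ i $ j"
    by (simp add: X_def)
  then obtain \<sigma> where \<sigma>: "\<And>i. i \<in> X \<Longrightarrow> 0 < d $ i $ \<sigma> i"
    by metis
  have "\<exists>i'. i \<in> X \<longrightarrow> d $ i' $ \<sigma> i < 0" for i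
    using \<sigma>[of i] sum_pos_if_sum_eq_0(2)[OF col, of i "\<sigma> i"] by fastforce
  then have "\<forall>j. \<exists>i'. j \<in> \<sigma> ` X \<longrightarrow> d $ i' $ j < 0"
    by blast
  then obtain \<tau> where "\<And>j. j \<in> \<sigma> ` X \<Longrightarrow> d $ \<tau> j $ j < 0"
    by metis
  then have \<tau>: "d $ \<tau> (\<sigma> i) $ \<sigma> i < 0" if "i \<in> X" for i
    using that by blast
  have "\<tau> (\<sigma> i) \<in> X" if "i \<in> X" for i
    using row_X[of "\<tau> (\<sigma> i)" "\<sigma> i"] \<tau>[OF that] by simp
  then have "(\<tau> \<circ> \<sigma>) ` X \<subseteq> X"
    by auto
  then obtain R where R: "R \<subseteq> X" "R \<noteq> {}" "(\<tau> \<circ> \<sigma>) ` R = R" "inj_on (\<tau> \<circ> \<sigma>) R"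
    using \<open>X \<noteq> {}\<close> minimal_invariant_subset[of X "\<tau> \<circ> \<sigma>"] by auto
  have inj: "inj_on \<sigma> R"
    using R(4) by (rule inj_on_imageI2)
  define p where "p i j = (if i \<in> R \<and> \<sigma> i = j then 1 else 0 :: real)" for i j
  define q where "q i j = (if j \<in> \<sigma> ` R \<and> \<tau> j = i then 1 else 0 :: real)" for i j
  define c :: "real^'n^'m" where "c = (\<chi> i j. p i j - q i j)"
  have p_row: "(\<Sum>j\<in>UNIV. p i j) = (if i \<in> R then 1 else 0)" for i
    by (auto simp: p_def)
  have q_col: "(\<Sum>i\<in>UNIV. q i j) = (if j \<in> \<sigma> ` R then 1 else 0)" for j
    by (auto simp: q_def)
  have p_col: "(\<Sum>i\<in>UNIV. p i j) = (if j \<in> \<sigma> ` R then 1 else 0)" for j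
  proof -
    have "(\<Sum>i\<in>UNIV. p i j) = (\<Sum>i\<in>R. if \<sigma> i = j then 1 else 0)"
      by (rule sum.mono_neutral_cong_right) (auto simp: p_def)
    also have "\<dots> = (\<Sum>j'\<in>\<sigma> ` R. if j' = j then 1 else 0)"
      by (simp add: sum.reindex[OF inj])
    also have "\<dots> = (if j \<in> \<sigma> ` R then 1 else 0)"
      by simp
    finally show ?thesis .
  qed
  have q_row: "(\<Sum>j\<in>UNIV. q i j) = (if i \<in> R then 1 else 0)" for i
  proof -
    have "(\<Sum>j\<in>UNIV. q i j) = (\<Sum>j\<in>\<sigma> ` R. if \<tau> j = i then 1 else 0)"
      by (rule sum.mono_neutral_cong_right) (auto simp: q_def)
    also have "\<dots> = (\<Sum>i'\<in>R. if (\<tau> \<circ> \<sigma>) i' = i then 1 else 0)"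
      by (simp add: sum.reindex[OF inj])
    also have "\<dots> = (\<Sum>i'\<in>(\<tau> \<circ> \<sigma>) ` R. if i' = i then 1 else 0)"
      by (subst sum.reindex[OF R(4)]) (simp add: comp_def)
    also have "\<dots> = (if i \<in> R then 1 else 0)"
      unfolding R(3) by simp
    finally show ?thesis .
  qed
  have p_pos: "0 < d $ i $ j" if "p i j \<noteq> 0" for i j
    using that \<sigma>[of i] R(1) by (auto simp: p_def split: if_splits)
  have q_neg: "d $ i $ j < 0" if "q i j \<noteq> 0" for i j
    using that \<tau> R(1) by (auto simp: q_def split: if_splits)
  have p01: "p i j \<in> {0, 1}" and q01: "q i j \<in> {0, 1}" for i j
    by (auto simp: p_def q_def)
  show thesis
  proof
    show "margins c = 0"
      by (simp add: margins_eq_0_iff c_def sum_subtractf p_row p_col q_row q_col)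
    show "c $ i $ j \<in> {0, sgn (d $ i $ j)}" for i j
      using p_pos[of i j] q_neg[of i j] p01[of i j] q01[of i j]
      by (cases "p i j = 0"; cases "q i j = 0") (auto simp: c_def)
    obtain i where "i \<in> R" using R(2) by blast
    then have "c $ i $ \<sigma> i \<noteq> 0"
      using p_pos[of i "\<sigma> i"] q_neg[of i "\<sigma> i"] by (cases "q i (\<sigma> i) = 0") (auto simp: c_def p_def)
    then show "c \<noteq> 0"
      by auto
  qed
qed

lemma Gcd_entries_eq_1:
  fixes z :: "int^'n^'m"
  assumes "\<bar>z $ i $ j\<bar> = 1"
  shows "Gcd {z $ i $ j | i j. True} = 1"
proof -
  have "Gcd {z $ i $ j | i j. True} dvd z $ i $ j"
    by (rule Gcd_dvd) blast
  also have "z $ i $ j dvd 1"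
    using assms by simp
  finally show ?thesis
    by simp
qed

text \<open>A sign-compatible cycle \<open>c\<close> of least support is already a circuit. A kernel
  vector \<open>h\<close> with smaller support could be scaled and subtracted from \<open>c\<close>
  without flipping a sign but with the loss of an entry; a cycle inside the difference would then
  beat \<open>c\<close>.\<close>

lemma exists_conformal_circuit:
  fixes d :: "real^'n^'m"
  assumes d: "margins d = 0" "d \<noteq> 0"
  obtains c :: "real^'n^'m" where "c \<in> circuits" "\<And>i j. c $ i $ j \<in> {0, sgn (d $ i $ j)}"
proof -
  let ?Q = "\<lambda>c :: real^'n^'m. margins c = 0 \<and> c \<noteq> 0 \<and> (\<forall>i j. c $ i $ j \<in> {0, sgn (d $ i $ j)})"
  obtain c0 where "?Q c0"
    using conformal_cycle[OF d] by metis
  then obtain c where c: "?Q c" and min: "\<And>c'. ?Q c' \<Longrightarrow> card (supp c) \<le> card (supp c')"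
    using ex_has_least_nat[of ?Q c0 "\<lambda>c. card (supp c)"] by blast
  have conf: "c $ i $ j \<in> {0, sgn (d $ i $ j)}" for i j
    using c by blast
  have c_abs: "\<bar>c $ i $ j\<bar> = 1" if "c $ i $ j \<noteq> 0" for i j
    using conf[of i j] that by (auto simp: sgn_if split: if_splits)
  have minimal: False if h: "margins h = 0" "h \<noteq> 0" "supp h \<subset> supp c" for h
  proof -
    obtain p where p: "p \<in> supp h"
      and max: "\<And>q. q \<in> supp h \<Longrightarrow> \<bar>h $ fst q $ snd q\<bar> \<le> \<bar>h $ fst p $ snd p\<bar>"
    proof -
      let ?f = "\<lambda>q. \<bar>h $ fst q $ snd q\<bar>"
      have "supp h \<noteq> {}" using h(2) by (simp add: supp_eq_empty_iff)
      then have "Max (?f ` supp h) \<in> ?f ` supp h"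
        by (intro Max_in) auto
      then obtain p where p: "Max (?f ` supp h) = ?f p" "p \<in> supp h"
        by (rule imageE)
      have "?f q \<le> ?f p" if "q \<in> supp h" for q
        unfolding p(1)[symmetric] using that by (intro Max_ge) auto
      with p(2) show thesis
        by (rule that)
    qed
    obtain k l where kl: "p = (k, l)" by (cases p)
    have hkl: "h $ k $ l \<noteq> 0" using p kl by simp
    have hle: "\<bar>h $ i $ j\<bar> \<le> \<bar>h $ k $ l\<bar>" for i j
      using max[of "(i, j)"] kl by (cases "h $ i $ j = 0") auto
    \<comment> \<open>The scaling matches \<open>c\<close> at the entry of \<open>h\<close> of
      largest modulus. Then all entries of \<open>t *\<^sub>R h\<close> have modulus at most 1,
      while the nonzero entries of \<open>c\<close> are 1 or -1, so \<open>e\<close> cannot change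
      sign against \<open>c\<close>.\<close>
    define t where "t = c $ k $ l / h $ k $ l"
    define e where "e = c - t *\<^sub>R h"
    have ckl: "\<bar>c $ k $ l\<bar> = 1"
      using p kl h(3) by (intro c_abs) (auto simp: supp_def)
    have th: "\<bar>t * h $ i $ j\<bar> \<le> 1" for i j
      using hle[of i j] hkl ckl by (simp add: t_def abs_mult divide_simps)
    have h0: "h $ i $ j = 0" if "c $ i $ j = 0" for i j
      using h(3) that by (auto simp: supp_def)
    have e_sgn: "sgn (e $ i $ j) \<in> {0, sgn (c $ i $ j)}" for i j
    proof (cases "c $ i $ j = 0")
      case True
      then show ?thesis using h0 by (simp add: e_def)
    next
      case False
      then show ?thesis
        using th[of i j] c_abs[OF False] by (auto simp: e_def sgn_if abs_if split: if_splits)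
    qed
    have supp_e: "supp e \<subset> supp c"
    proof
      show "supp e \<subseteq> supp c"
        using h0 by (auto simp: supp_subset_iff e_def)
      have "(k, l) \<in> supp c" "(k, l) \<notin> supp e"
        using ckl hkl by (auto simp: e_def t_def)
      then show "supp e \<noteq> supp c" by blast
    qed
    have "e \<noteq> 0"
    proof
      assume "e = 0"
      then have "c = t *\<^sub>R h" by (simp add: e_def)
      then have "supp c \<subseteq> supp h" by (auto simp: supp_def)
      with h(3) show False by blast
    qed
    moreover have "margins e = 0"
      using c h(1) by (simp add: e_def margins_diff margins_scaleR)
    ultimately obtain c' where c': "margins c' = 0" "c' \<noteq> 0"
      "\<And>i j. c' $ i $ j \<in> {0, sgn (e $ i $ j)}"
      using conformal_cycle by metis
    have "?Q c'"
    proof (intro conjI allI)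
      show "c' $ i $ j \<in> {0, sgn (d $ i $ j)}" for i j
        using c'(3)[of i j] e_sgn[of i j] conf[of i j] by auto
    qed (use c' in auto)
    then have "card (supp c) \<le> card (supp c')"
      by (rule min)
    also have "supp c' \<subseteq> supp e"
      using c'(3) by (fastforce simp: supp_subset_iff)
    then have "card (supp c') \<le> card (supp e)"
      by (intro card_mono) auto
    also have "card (supp e) < card (supp c)"
      using supp_e by (intro psubset_card_mono) auto
    finally show False by simp
  qed
  define z :: "int^'n^'m" where "z = (\<chi> i j. \<lfloor>c $ i $ j\<rfloor>)"
  have cz: "c $ i $ j = of_int (z $ i $ j)" for i j
    using conf[of i j] by (auto simp: z_def sgn_if)
  obtain i j where "c $ i $ j \<noteq> 0"
    using c by (auto simp: vec_eq_iff)
  then have "\<bar>z $ i $ j\<bar> = 1"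
    using c_abs[of i j] cz[of i j] by linarith
  then have "c \<in> circuits"
    using c minimal cz Gcd_entries_eq_1[of z i j] unfolding circuits_def by blast
  with conf that show thesis by blast
qed

text \<open>Induction on the dimension of the cycle space of the remaining difference: each maximal
  conformal step removes a coordinate from its support and lowers that dimension.\<close>

lemma feasible_walk_exists:
  fixes w1 w2 :: "real^'n^'m"
  assumes "w1 \<in> transportation_polytope u v" "w2 \<in> transportation_polytope u v"
  shows "\<exists>k \<le> dim (kernel_on (supp (w2 - w1))).
           \<exists>y. feasible_circuit_walk (transportation_polytope u v) k y w1 w2"
  using assms(1)
proof (induction "dim (kernel_on (supp (w2 - w1)))" arbitrary: w1 rule: less_induct)
  case less
  let ?P = "transportation_polytope u v"
  show ?case
  proof (cases "w1 = w2")
    case True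
    then have "feasible_circuit_walk ?P 0 (\<lambda>_. w1) w1 w2"
      using assms(2) by (simp add: feasible_circuit_walk_def circuit_walk_def)
    then show ?thesis by blast
  next
    case False
    define d where "d = w2 - w1"
    have d: "margins d = 0" "d \<noteq> 0"
      using False less.prems assms(2) by (auto simp: d_def margins_diff transportation_polytope_def)
    obtain c where c: "c \<in> circuits" "\<And>i j. c $ i $ j \<in> {0, sgn (d $ i $ j)}"
      using exists_conformal_circuit[OF d] by blast
    have c0: "margins c = 0" "c \<noteq> 0"
      using c(1) by (auto simp: circuits_def)
    let ?f = "\<lambda>q. \<bar>d $ fst q $ snd q\<bar>"
    \<comment> \<open>The longest step that overshoots no coordinate: each entry stays between those
      of \<open>w1\<close> and \<open>w2\<close>, which gives feasibility, and at a minimizing entry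
      the target is reached.\<close>
    define \<alpha> where "\<alpha> = Min (?f ` supp c)"
    have ne: "?f ` supp c \<noteq> {}" "finite (?f ` supp c)"
      using c0 by (auto simp: supp_eq_empty_iff)
    obtain k l where kl: "c $ k $ l \<noteq> 0" "\<bar>d $ k $ l\<bar> = \<alpha>"
      using Min_in[OF ne(2,1)] by (auto simp: \<alpha>_def)
    have le: "\<alpha> \<le> \<bar>d $ i $ j\<bar>" if "c $ i $ j \<noteq> 0" for i j
      unfolding \<alpha>_def using ne that by (intro Min_le image_eqI[of _ _ "(i, j)"]) auto
    have "d $ k $ l \<noteq> 0"
      using kl(1) c(2)[of k l] by auto
    then have "0 < \<alpha>" using kl by auto
    define w where "w = w1 + \<alpha> *\<^sub>R c"
    have between: "(0 \<le> w $ i $ j) \<and> (d $ i $ j = 0 \<longrightarrow> w $ i $ j = w2 $ i $ j)" for i j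
    proof -
      have nn: "0 \<le> w1 $ i $ j" "0 \<le> w2 $ i $ j"
        using less.prems assms(2) by (auto simp: transportation_polytope_def)
      show ?thesis
      proof (cases "c $ i $ j = 0")
        case True
        then show ?thesis using nn by (simp add: w_def d_def)
      next
        case False
        then have "c $ i $ j = sgn (d $ i $ j)" "d $ i $ j \<noteq> 0"
          using c(2)[of i j] by auto
        then show ?thesis
          using le[OF False] nn \<open>0 < \<alpha>\<close>
          by (auto simp: w_def d_def sgn_if abs_if split: if_splits)
      qed
    qed
    have wP: "w \<in> ?P"
      using less.prems between c0
      by (auto simp: transportation_polytope_def w_def margins_add margins_scaleR)
    have d': "w2 - w = d - \<alpha> *\<^sub>R c"
      by (simp add: w_def d_def)
    have "(k, l) \<notin> supp (w2 - w)"
      using kl c(2)[of k l] unfolding d' by (auto simp: sgn_if abs_if split: if_splits)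
    \<comment> \<open>The old difference \<open>d\<close> itself witnesses the strict inclusion of
      the new space in the old one.\<close>
    then have "d \<notin> kernel_on (supp (w2 - w))"
      using \<open>d $ k $ l \<noteq> 0\<close> by (auto simp: kernel_on_def supp_subset_iff)
    moreover have "d \<in> kernel_on (supp (w2 - w1))"
      using d by (simp add: kernel_on_def d_def)
    moreover have "kernel_on (supp (w2 - w)) \<subseteq> kernel_on (supp (w2 - w1))"
      using between by (intro kernel_on_mono) (auto simp: supp_def d_def)
    ultimately have lt: "dim (kernel_on (supp (w2 - w))) < dim (kernel_on (supp (w2 - w1)))"
      by (intro dim_psubset) (auto simp: span_eq_iff[THEN iffD2, OF subspace_kernel_on])
    obtain n y where n: "n \<le> dim (kernel_on (supp (w2 - w)))"
      and y: "feasible_circuit_walk ?P n y w w2"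
      using less.hyps[OF lt wP] by blast
    define y' where "y' = case_nat w1 y"
    have "feasible_circuit_walk ?P (Suc n) y' w1 w2"
      unfolding feasible_circuit_walk_def circuit_walk_def
    proof (intro conjI allI impI)
      show "y' 0 = w1" "y' (Suc n) = w2"
        using y by (simp_all add: y'_def feasible_circuit_walk_def circuit_walk_def)
      show "y' i \<in> ?P" if "i \<le> Suc n" for i
        using y that less.prems by (cases i) (auto simp: y'_def feasible_circuit_walk_def)
      show "\<exists>g\<in>circuits. \<exists>\<alpha>>0. y' (Suc i) - y' i = \<alpha> *\<^sub>R g" if i: "i < Suc n" for i
      proof (cases i)
        case 0
        have "y' (Suc i) - y' i = \<alpha> *\<^sub>R c"
          using y by (simp add: 0 y'_def feasible_circuit_walk_def circuit_walk_def w_def)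
        then show ?thesis using c(1) \<open>0 < \<alpha>\<close> by blast
      next
        case (Suc i')
        then show ?thesis
          using y i by (simp add: y'_def feasible_circuit_walk_def circuit_walk_def)
      qed
    qed
    moreover have "Suc n \<le> dim (kernel_on (supp (w2 - w1)))"
      using n lt by simp
    ultimately show ?thesis by blast
  qed
qed

text \<open>Acyclicity enters twice: for \<open>w1\<close> it bounds the dimension by
  \<open>card (supp w2)\<close>, and for \<open>w2\<close> it bounds that cardinality.\<close>

lemma feasible_circuit_diameter_le:
  "feasible_circuit_diameter (transportation_polytope u v) \<le> enat (CARD('m) + CARD('n) - 1)"
  for u :: "real^'m" and v :: "real^'n"
  unfolding feasible_circuit_diameter_def
proof (intro SUP_least)
  let ?P = "transportation_polytope u v"
  fix w1 w2 assume w: "w1 \<in> vertices ?P" "w2 \<in> vertices ?P"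
  then have P: "w1 \<in> ?P" "w2 \<in> ?P"
    by (auto simp: vertices_def extreme_point_of_def)
  obtain k y where k: "k \<le> dim (kernel_on (supp (w2 - w1)))"
    and y: "feasible_circuit_walk ?P k y w1 w2"
    using feasible_walk_exists[OF P] by blast
  have "feasible_circuit_distance ?P w1 w2 \<le> enat k"
    unfolding feasible_circuit_distance_def using y by (intro Inf_lower) blast
  also have "k \<le> CARD('m) + CARD('n) - 1"
    using k dim_kernel_on_diff_le[OF forest_if_vertex[OF w(1)], of w2]
      card_forest_le[OF forest_if_vertex[OF w(2)]] by linarith
  finally show "feasible_circuit_distance ?P w1 w2 \<le> enat (CARD('m) + CARD('n) - 1)"
    by simp
qed

lemma circuit_diameter_le_feasible:
  "circuit_diameter P \<le> feasible_circuit_diameter P"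
  unfolding circuit_diameter_def feasible_circuit_diameter_def
proof (intro SUP_mono')
  fix w1 w2
  show "circuit_distance w1 w2 \<le> feasible_circuit_distance P w1 w2"
    unfolding circuit_distance_def feasible_circuit_distance_def
    by (rule Inf_superset_mono) (auto simp: feasible_circuit_walk_def)
qed

section \<open>A generic difference of vertices needs many circuits\<close>

lemma finite_line_Int_subspace:
  fixes x y :: "'a::real_vector"
  assumes U: "subspace U" and x: "x \<notin> U"
  shows "finite {t. y + t *\<^sub>R x \<in> U}"
proof -
  have "t = t'" if "y + t *\<^sub>R x \<in> U" "y + t' *\<^sub>R x \<in> U" for t t'
  proof (rule ccontr)
    assume "t \<noteq> t'"
    have "(y + t *\<^sub>R x) - (y + t' *\<^sub>R x) \<in> U"
      using U that by (rule subspace_diff)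
    then have "(t - t') *\<^sub>R x \<in> U"
      by (simp add: algebra_simps)
    then have "inverse (t - t') *\<^sub>R (t - t') *\<^sub>R x \<in> U"
      using U by (rule subspace_scale[rotated])
    with \<open>t \<noteq> t'\<close> x show False by simp
  qed
  then have "\<exists>t0. {t. y + t *\<^sub>R x \<in> U} \<subseteq> {t0}"
    by blast
  then show ?thesis
    using finite_subset by blast
qed

text \<open>A real vector space is not a finite union of proper subspaces. In the induction step
  \<open>x\<close> avoids the old subspaces and \<open>y\<close> the new one; the line
  \<open>y + t *\<^sub>R x\<close> meets each of them for finitely many \<open>t\<close>
  only.\<close>

lemma subspace_avoiding_finite_union:
  fixes V :: "'a::real_vector set"
  assumes "finite \<U>" and V: "subspace V"
    and "\<And>U. U \<in> \<U> \<Longrightarrow> subspace U \<and> \<not> V \<subseteq> U"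
  shows "\<exists>x\<in>V. \<forall>U\<in>\<U>. x \<notin> U"
  using assms(1,3)
proof (induction \<U> rule: finite_induct)
  case empty
  show ?case using subspace_0[OF V] by blast
next
  case (insert U \<U>)
  have "\<exists>x\<in>V. \<forall>U\<in>\<U>. x \<notin> U"
    by (rule insert.IH) (use insert.prems in blast)
  then obtain x where x: "x \<in> V" "\<And>U'. U' \<in> \<U> \<Longrightarrow> x \<notin> U'"
    by blast
  obtain y where y: "y \<in> V" "y \<notin> U"
    using insert.prems by blast
  have "finite {t. y + t *\<^sub>R x \<in> U'}" if "U' \<in> insert U \<U>" for U'
  proof (cases "x \<in> U'")
    case True
    \<comment> \<open>Only the new subspace can contain \<open>x\<close>; the line is then parallel
      to it and starts outside at \<open>y\<close>.\<close>
    then have "U' = U" using that x by blast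
    have "y + t *\<^sub>R x \<notin> U" for t
    proof
      assume "y + t *\<^sub>R x \<in> U"
      then have "(y + t *\<^sub>R x) - t *\<^sub>R x \<in> U"
        using True insert.prems \<open>U' = U\<close> by (blast intro: subspace_diff subspace_scale)
      with y(2) show False by simp
    qed
    then show ?thesis using \<open>U' = U\<close> by simp
  next
    case False
    then show ?thesis
      using insert.prems that by (blast intro: finite_line_Int_subspace)
  qed
  then have "finite (\<Union>U'\<in>insert U \<U>. {t. y + t *\<^sub>R x \<in> U'})"
    using insert.hyps(1) by blast
  then obtain t where t: "t \<notin> (\<Union>U'\<in>insert U \<U>. {t. y + t *\<^sub>R x \<in> U'})"
    using ex_new_if_finite[OF infinite_UNIV_char_0] by blast
  have "y + t *\<^sub>R x \<in> V"
    using V x(1) y(1) by (blast intro: subspace_add subspace_scale)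
  with t show ?case by blast
qed

text \<open>A stock of directions whose finiteness is read off from the entries. It contains a
  spanning vector for the line through each circuit.\<close>

definition sign_arrays :: "(real^'n^'m) set" where
  "sign_arrays = {c. \<forall>i j. c $ i $ j \<in> {-1, 0, 1}}"

lemma finite_sign_arrays: "finite (sign_arrays :: (real^'n^'m) set)"
proof -
  let ?F = "(UNIV :: ('m \<times> 'n) set) \<rightarrow>\<^sub>E {-1, 0, 1 :: real}"
  have "c \<in> (\<lambda>f. \<chi> i j. f (i, j)) ` ?F" if "c \<in> sign_arrays" for c :: "real^'n^'m"
    using that by (intro image_eqI[of _ _ "\<lambda>(i, j). c $ i $ j"])
      (auto simp: vec_eq_iff sign_arrays_def PiE_def)
  then have "sign_arrays \<subseteq> (\<lambda>f. (\<chi> i j. f (i, j)) :: real^'n^'m) ` ?F"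
    by blast
  then show ?thesis
    by (rule finite_subset) (intro finite_imageI finite_PiE; simp)
qed

text \<open>A circuit contains a conformal cycle \<open>c\<close>; subtracting the multiple of
  \<open>c\<close> that kills one entry leaves a kernel vector of strictly smaller support, which
  minimality forces to be zero.\<close>

lemma circuit_in_span_sign_array:
  fixes g :: "real^'n^'m"
  assumes "g \<in> circuits"
  shows "\<exists>c\<in>sign_arrays. g \<in> span {c}"
proof -
  have g: "margins g = 0" "g \<noteq> 0"
    and min: "\<And>h. margins h = 0 \<Longrightarrow> h \<noteq> 0 \<Longrightarrow> \<not> supp h \<subset> supp g"
    using assms by (auto simp: circuits_def)
  obtain c where c: "margins c = 0" "c \<noteq> 0" "\<And>i j. c $ i $ j \<in> {0, sgn (g $ i $ j)}"
    using conformal_cycle[OF g] by metis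
  obtain k l where kl: "c $ k $ l \<noteq> 0"
    using c(2) by (auto simp: vec_eq_iff)
  define a where "a = g $ k $ l / c $ k $ l"
  have c0: "c $ i $ j = 0" if "g $ i $ j = 0" for i j
    using c(3)[of i j] that by simp
  have "g - a *\<^sub>R c = 0"
  proof (rule ccontr)
    assume "g - a *\<^sub>R c \<noteq> 0"
    moreover have "margins (g - a *\<^sub>R c) = 0"
      using g c by (simp add: margins_diff margins_scaleR)
    ultimately have "\<not> supp (g - a *\<^sub>R c) \<subset> supp g"
      by (rule min[rotated])
    moreover have "supp (g - a *\<^sub>R c) \<subseteq> supp g"
      using c0 by (auto simp: supp_subset_iff)
    moreover have "(k, l) \<in> supp g" "(k, l) \<notin> supp (g - a *\<^sub>R c)"
      using kl c0[of k l] by (auto simp: a_def)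
    ultimately show False by blast
  qed
  then have "g \<in> span {c}"
    by (auto simp: span_singleton)
  moreover have "c \<in> sign_arrays"
  proof -
    have "c $ i $ j \<in> {-1, 0, 1}" for i j
      using c(3)[of i j] by (auto simp: sgn_if split: if_splits)
    then show ?thesis by (simp add: sign_arrays_def)
  qed
  ultimately show ?thesis by blast
qed

text \<open>Each step contributes at most one new direction. This turns the length of a walk into a
  linear-algebra invariant of its end points.\<close>

lemma walk_difference_in_span:
  fixes w1 w2 :: "real^'n^'m"
  assumes "circuit_walk k y w1 w2"
  obtains C where "C \<subseteq> sign_arrays" "card C \<le> k" "w2 - w1 \<in> span C"
proof -
  have "\<exists>C\<subseteq>sign_arrays. card C \<le> l \<and> y l - y 0 \<in> span C" if "l \<le> k" for l
    using that
  proof (induction l)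
    case 0
    then show ?case by (intro exI[of _ "{}"]) simp
  next
    case (Suc l)
    then obtain C where C: "C \<subseteq> sign_arrays" "card C \<le> l" "y l - y 0 \<in> span C"
      by auto
    obtain g \<alpha> where g: "g \<in> circuits" "y (Suc l) - y l = \<alpha> *\<^sub>R g"
      using assms Suc.prems unfolding circuit_walk_def by (meson Suc_le_eq)
    obtain c where c: "c \<in> sign_arrays" "g \<in> span {c}"
      using circuit_in_span_sign_array[OF g(1)] by blast
    have "\<alpha> *\<^sub>R g \<in> span (insert c C)"
      using span_mono[of "{c}" "insert c C"] c(2) by (blast intro: span_scale)
    moreover have "y l - y 0 \<in> span (insert c C)"
      using span_mono[of C "insert c C"] C(3) by blast
    ultimately have "\<alpha> *\<^sub>R g + (y l - y 0) \<in> span (insert c C)"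
      by (rule span_add)
    then have "y (Suc l) - y 0 \<in> span (insert c C)"
      unfolding g(2)[symmetric] by simp
    moreover have "card (insert c C) \<le> Suc l"
      using C(1,2) finite_subset[OF C(1) finite_sign_arrays] by (simp add: card_insert_if)
    ultimately show ?case using C(1) c(1) by blast
  qed
  from this[of k] that show thesis
    using assms by (auto simp: circuit_walk_def)
qed

lemma exists_generic_vertex_pair:
  fixes x y :: "real^'n^'m"
  assumes nn: "\<And>i j. 0 \<le> x $ i $ j" "\<And>i j. 0 \<le> y $ i $ j"
    and eq: "margins x = margins y"
    and forests: "forest (supp x)" "forest (supp y)"
    and rows: "\<And>i. \<exists>j. x $ i $ j \<noteq> 0" and cols: "\<And>j. \<exists>i. x $ i $ j \<noteq> 0"
  shows "\<exists>(u :: real^'m) (v :: real^'n). (\<forall>i. 0 < u $ i) \<and> (\<forall>j. 0 < v $ j)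
    \<and> (\<Sum>i\<in>UNIV. u $ i) = (\<Sum>j\<in>UNIV. v $ j)
    \<and> enat (dim (kernel_on (supp x \<union> supp y))) \<le> circuit_diameter (transportation_polytope u v)"
proof -
  define V where "V = kernel_on (supp x \<union> supp y)"
  \<comment> \<open>A walk of \<open>k\<close> steps puts \<open>w2 - w1\<close> into the span of at
    most \<open>k\<close> sign arrays, so a difference outside every member of \<open>\<U>\<close>
    rules out all walks shorter than \<open>dim V\<close>.\<close>
  define \<U> where "\<U> = span ` {C :: (real^'n^'m) set. C \<subseteq> sign_arrays \<and> card C < dim V}"
  have "finite \<U>"
    unfolding \<U>_def
    by (rule finite_imageI, rule finite_subset[of _ "Pow sign_arrays"])
      (auto simp: finite_sign_arrays)
  moreover have \<U>: "subspace U \<and> \<not> V \<subseteq> U" if U: "U \<in> \<U>" for U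
  proof -
    obtain C where C: "C \<subseteq> sign_arrays" "card C < dim V" "U = span C"
      using U by (auto simp: \<U>_def)
    have "\<not> V \<subseteq> span C"
      using C(2) dim_le_card[of V C] finite_subset[OF C(1) finite_sign_arrays] by linarith
    then show ?thesis using C(3) by simp
  qed
  moreover have "subspace V"
    unfolding V_def by (rule subspace_kernel_on)
  ultimately have "\<exists>h\<in>V. \<forall>U\<in>\<U>. h \<notin> U"
    by (intro subspace_avoiding_finite_union) auto
  then obtain h where h: "h \<in> V" "\<And>U. U \<in> \<U> \<Longrightarrow> h \<notin> U"
    by blast
  \<comment> \<open>Since \<open>h\<close> avoids every member of \<open>\<U>\<close>, each excludes
    at most finitely many \<open>t\<close>, and sufficiently small positive \<open>t\<close> are
    admissible.\<close>
  define bad where "bad = (\<Union>U\<in>\<U>. {t. (y - x) + t *\<^sub>R h \<in> U})"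
  have "finite bad"
    unfolding bad_def using \<open>finite \<U>\<close> \<U> h(2) by (blast intro: finite_line_Int_subspace)
  then have "\<forall>\<^sub>F t in at_right 0. \<forall>s\<in>bad. t \<noteq> s"
    by (rule eventually_ball_finite) (simp add: eventually_neq_at_within)
  then have "\<forall>\<^sub>F t in at_right 0. t \<notin> bad"
    by eventually_elim blast
  moreover have "\<forall>\<^sub>F t in at_right 0. z $ i $ j \<noteq> 0 \<longrightarrow> \<bar>t * h $ i $ j\<bar> < z $ i $ j"
    if "0 \<le> z $ i $ j" for i j and z :: "real^'n^'m"
  proof (cases "z $ i $ j = 0")
    case False
    have "((\<lambda>t. \<bar>t * h $ i $ j\<bar>) \<longlongrightarrow> \<bar>0 * h $ i $ j\<bar>) (at_right 0)"
      by (intro tendsto_intros)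
    then have "\<forall>\<^sub>F t in at_right 0. \<bar>t * h $ i $ j\<bar> < z $ i $ j"
      using that False by (intro order_tendstoD(2)) auto
    then show ?thesis by eventually_elim simp
  qed simp
  then have "\<forall>\<^sub>F t in at_right 0. \<forall>i j. x $ i $ j \<noteq> 0 \<longrightarrow> \<bar>t * h $ i $ j\<bar> < x $ i $ j"
    "\<forall>\<^sub>F t in at_right 0. \<forall>i j. y $ i $ j \<noteq> 0 \<longrightarrow> \<bar>t * h $ i $ j\<bar> < y $ i $ j"
    using nn by (auto intro!: eventually_all_finite)
  ultimately have "\<forall>\<^sub>F t in at_right 0. t \<notin> bad
      \<and> (\<forall>i j. x $ i $ j \<noteq> 0 \<longrightarrow> \<bar>t * h $ i $ j\<bar> < x $ i $ j)
      \<and> (\<forall>i j. y $ i $ j \<noteq> 0 \<longrightarrow> \<bar>t * h $ i $ j\<bar> < y $ i $ j)"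
    by eventually_elim simp
  then obtain t where t: "t \<notin> bad"
    and tx: "\<And>i j. x $ i $ j \<noteq> 0 \<Longrightarrow> \<bar>t * h $ i $ j\<bar> < x $ i $ j"
    and ty: "\<And>i j. y $ i $ j \<noteq> 0 \<Longrightarrow> \<bar>t * h $ i $ j\<bar> < y $ i $ j"
    using eventually_happens[of _ "at_right (0::real)"] by force
  define d where "d = (y - x) + t *\<^sub>R h"
  \<comment> \<open>The perturbation is split by support: \<open>x\<close> absorbs
    \<open>- t *\<^sub>R h\<close> on \<open>supp x\<close>; then \<open>w2\<close> equals
    \<open>y\<close> on \<open>supp x\<close> and \<open>y + t *\<^sub>R h\<close> elsewhere. Both
    supports survive and the two arrays still have equal margins.\<close>
  define w1 :: "real^'n^'m" where
    "w1 = (\<chi> i j. if x $ i $ j \<noteq> 0 then x $ i $ j - t * h $ i $ j else 0)"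
  define w2 where "w2 = w1 + d"
  have h0: "h $ i $ j = 0" if "x $ i $ j = 0" "y $ i $ j = 0" for i j
    using h(1) that by (auto simp: V_def kernel_on_def supp_subset_iff)
  have w1: "0 \<le> w1 $ i $ j \<and> (w1 $ i $ j = 0 \<longleftrightarrow> x $ i $ j = 0)" for i j
    using tx[of i j] by (auto simp: w1_def)
  have w2: "0 \<le> w2 $ i $ j \<and> (w2 $ i $ j = 0 \<longleftrightarrow> y $ i $ j = 0)" for i j
    using ty[of i j] h0[of i j] nn(2)[of i j]
    by (cases "x $ i $ j = 0"; cases "y $ i $ j = 0") (auto simp: w2_def d_def w1_def)
  obtain u v where uv: "margins w1 = (u, v)"
    by (cases "margins w1")
  have u: "u $ i = (\<Sum>j\<in>UNIV. w1 $ i $ j)" and v: "v $ j = (\<Sum>i\<in>UNIV. w1 $ i $ j)" for i j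
    using uv by (auto simp: margins_def)
  have "margins d = 0"
    using eq h(1) by (simp add: d_def margins_add margins_diff margins_scaleR V_def kernel_on_def)
  then have P: "w1 \<in> transportation_polytope u v" "w2 \<in> transportation_polytope u v"
    using w1 w2 uv by (auto simp: transportation_polytope_def w2_def margins_add)
  have supp: "supp w1 = supp x" "supp w2 = supp y"
    using w1 w2 by (auto simp: supp_def)
  have vert: "w1 \<in> vertices (transportation_polytope u v)" "w2 \<in> vertices (transportation_polytope u v)"
    using P forests by (auto intro!: vertex_if_forest simp: supp)
  have "enat (dim V) \<le> circuit_distance w1 w2"
    unfolding circuit_distance_def
  proof (intro Inf_greatest)
    fix e assume "e \<in> {enat k |k. \<exists>y. circuit_walk k y w1 w2}"
    then obtain k z where k: "e = enat k" "circuit_walk k z w1 w2"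
      by blast
    obtain C where C: "C \<subseteq> sign_arrays" "card C \<le> k" "w2 - w1 \<in> span C"
      using walk_difference_in_span[OF k(2)] by blast
    have "span C \<notin> \<U>"
      using t C(3) by (auto simp: bad_def w2_def d_def)
    then have "dim V \<le> k"
      using C(1,2) by (fastforce simp: \<U>_def)
    then show "enat (dim V) \<le> e"
      using k(1) by simp
  qed
  also have "\<dots> \<le> circuit_diameter (transportation_polytope u v)"
    unfolding circuit_diameter_def using vert by (meson SUP_upper order_trans)
  finally have "enat (dim V) \<le> circuit_diameter (transportation_polytope u v)" .
  moreover have "0 < u $ i" for i
  proof -
    obtain j where "x $ i $ j \<noteq> 0" using rows by blast
    then show ?thesis
      unfolding u using w1 by (intro sum_pos2[of _ j]) (auto simp: less_le)
  qed
  moreover have "0 < v $ j" for j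
  proof -
    obtain i where "x $ i $ j \<noteq> 0" using cols by blast
    then show ?thesis
      unfolding v using w1 by (intro sum_pos2[of _ i]) (auto simp: less_le)
  qed
  moreover have "(\<Sum>i\<in>UNIV. u $ i) = (\<Sum>j\<in>UNIV. v $ j)"
    unfolding u v by (rule sum.swap)
  ultimately show ?thesis
    unfolding V_def by (intro exI[of _ u] exI[of _ v] conjI allI)
qed

section \<open>Spanning trees\<close>

definition unit_array :: "'m \<Rightarrow> 'n \<Rightarrow> real^'n^'m" where
  "unit_array i j = axis i (axis j 1)"

lemma unit_array_nth: "unit_array i j $ k $ l = (if k = i \<and> l = j then 1 else 0)"
  by (simp add: unit_array_def axis_def)

lemma unit_array_nonneg: "0 \<le> unit_array i j $ k $ l"
  by (simp add: unit_array_nth)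

lemma margins_unit_array: "margins (unit_array i j) = (axis i 1, axis j 1)"
proof -
  have "(\<Sum>l\<in>UNIV. unit_array i j $ k $ l) = (if k = i then 1 else 0)" for k
    by (simp add: unit_array_nth)
  moreover have "(\<Sum>k\<in>UNIV. unit_array i j $ k $ l) = (if l = j then 1 else 0)" for l
    by (simp add: unit_array_nth)
  ultimately show ?thesis
    by (simp add: margins_def axis_def vec_eq_iff)
qed

text \<open>Trees grow by leaf edges, so that acyclicity and the existence of connecting paths both
  follow by rule induction, without a notion of path or cycle.\<close>

inductive spanning_tree ::
    "'m::finite set \<Rightarrow> 'n::finite set \<Rightarrow> ('m \<times> 'n) set \<Rightarrow> bool" where
  single: "spanning_tree {i} {j} {(i, j)}"
| row: "spanning_tree A B T \<Longrightarrow> i \<notin> A \<Longrightarrow> j \<in> B \<Longrightarrow> spanning_tree (insert i A) B (insert (i, j) T)"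
| col: "spanning_tree A B T \<Longrightarrow> i \<in> A \<Longrightarrow> j \<notin> B \<Longrightarrow> spanning_tree A (insert j B) (insert (i, j) T)"

lemma spanning_tree_subset: "spanning_tree A B T \<Longrightarrow> T \<subseteq> A \<times> B"
  by (induction rule: spanning_tree.induct) auto

lemma spanning_tree_covers_rows: "spanning_tree A B T \<Longrightarrow> i \<in> A \<Longrightarrow> \<exists>j. (i, j) \<in> T"
  by (induction rule: spanning_tree.induct) auto

lemma spanning_tree_covers_cols: "spanning_tree A B T \<Longrightarrow> j \<in> B \<Longrightarrow> \<exists>i. (i, j) \<in> T"
  by (induction rule: spanning_tree.induct) auto

lemma spanning_tree_swap: "spanning_tree A B T \<Longrightarrow> spanning_tree B A (prod.swap ` T)"
  by (induction rule: spanning_tree.induct) (auto intro: spanning_tree.intros)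

text \<open>In the new row a kernel vector has at most one nonzero entry, and the zero row sum makes
  that entry vanish.\<close>

lemma forest_insert_row_leaf:
  assumes "forest T" and leaf: "\<And>l. (i, l) \<notin> T"
  shows "forest (insert (i, j) T)"
proof (rule forestI)
  fix h assume h: "margins h = 0" "supp h \<subseteq> insert (i, j) T"
  have off: "h $ i $ l = 0" if "l \<noteq> j" for l
    using h(2) leaf[of l] that by (auto simp: supp_subset_iff)
  have "(\<Sum>l\<in>UNIV. h $ i $ l) = (\<Sum>l\<in>{j}. h $ i $ l)"
    using off by (intro sum.mono_neutral_right) auto
  then have "h $ i $ j = 0"
    using h(1) by (simp add: margins_eq_0_iff)
  then have "supp h \<subseteq> T"
    using h(2) by (auto simp: supp_subset_iff)
  with assms(1) h(1) show "h = 0"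
    by (rule forestD)
qed

lemma forest_insert_col_leaf:
  assumes "forest T" and leaf: "\<And>k. (k, j) \<notin> T"
  shows "forest (insert (i, j) T)"
proof (rule forestI)
  fix h assume h: "margins h = 0" "supp h \<subseteq> insert (i, j) T"
  have off: "h $ k $ j = 0" if "k \<noteq> i" for k
    using h(2) leaf[of k] that by (auto simp: supp_subset_iff)
  have "(\<Sum>k\<in>UNIV. h $ k $ j) = (\<Sum>k\<in>{i}. h $ k $ j)"
    using off by (intro sum.mono_neutral_right) auto
  then have "h $ i $ j = 0"
    using h(1) by (simp add: margins_eq_0_iff)
  then have "supp h \<subseteq> T"
    using h(2) by (auto simp: supp_subset_iff)
  with assms(1) h(1) show "h = 0"
    by (rule forestD)
qed

lemma forest_if_spanning_tree: "spanning_tree A B T \<Longrightarrow> forest T"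
proof (induction rule: spanning_tree.induct)
  case (single i j)
  have "forest {}"
    by (rule forestI) (simp add: supp_eq_empty_iff)
  then show ?case
    by (rule forest_insert_row_leaf) simp
next
  case (row A B T i j)
  then show ?case
    using spanning_tree_subset by (intro forest_insert_row_leaf) blast+
next
  case (col A B T i j)
  then show ?case
    using spanning_tree_subset by (intro forest_insert_col_leaf) blast+
qed

lemma supp_add_subset: "supp x \<subseteq> S \<Longrightarrow> supp y \<subseteq> S \<Longrightarrow> supp (x + y) \<subseteq> S"
  by (simp add: supp_subset_iff)

lemma supp_diff_subset: "supp x \<subseteq> S \<Longrightarrow> supp y \<subseteq> S \<Longrightarrow> supp (x - y) \<subseteq> S"
  by (simp add: supp_subset_iff)

lemma supp_unit_array: "supp (unit_array i j) = {(i, j)}"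
  by (auto simp: supp_def unit_array_nth split: if_splits)

lemma supp_scaleR_unit_array: "s \<noteq> 0 \<Longrightarrow> supp (s *\<^sub>R unit_array i j) = {(i, j)}"
  by (auto simp: supp_def unit_array_nth split: if_splits)

text \<open>In a tree, the edge \<open>(i, j)\<close> can be replaced by the path joining its end points, with alternating signs.\<close>

lemma spanning_tree_path:
  "spanning_tree A B T \<Longrightarrow> i \<in> A \<Longrightarrow> j \<in> B
    \<Longrightarrow> \<exists>c. supp c \<subseteq> T \<and> margins c = margins (unit_array i j)"
proof (induction arbitrary: i j rule: spanning_tree.induct)
  case (single i j)
  then show ?case
    by (intro exI[of _ "unit_array i j"]) (simp add: supp_unit_array)
next
  case (row A B T i' j')
  let ?S = "insert (i', j') T"
  show ?case
  proof (cases "i = i'")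
    case False
    then show ?thesis using row.IH[of i j] row.prems by blast
  next
    case True
    \<comment> \<open>Any old row serves as an intermediate stop: the new edge leads from
      \<open>i'\<close> to \<open>j'\<close>, and \<open>c1 - c2\<close> carries on from
      \<open>j'\<close> through \<open>k\<close> to \<open>j\<close> inside the old tree.\<close>
    obtain k where k: "k \<in> A"
      using row.hyps(1) by (induction rule: spanning_tree.induct) auto
    obtain c1 where c1: "supp c1 \<subseteq> T" "margins c1 = margins (unit_array k j)"
      using row.IH[of k j] row.prems k by blast
    obtain c2 where c2: "supp c2 \<subseteq> T" "margins c2 = margins (unit_array k j')"
      using row.IH[of k j'] row.hyps k by blast
    have "supp (unit_array i' j' + (c1 - c2)) \<subseteq> ?S"
      using c1(1) c2(1) by (intro supp_add_subset supp_diff_subset) (auto simp: supp_unit_array)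
    moreover have "margins (unit_array i' j' + (c1 - c2)) = margins (unit_array i j)"
      using c1(2) c2(2) True by (simp add: margins_add margins_diff margins_unit_array)
    ultimately show ?thesis by blast
  qed
next
  case (col A B T i' j')
  let ?S = "insert (i', j') T"
  show ?case
  proof (cases "j = j'")
    case False
    then show ?thesis using col.IH[of i j] col.prems by blast
  next
    case True
    obtain l where l: "l \<in> B"
      using col.hyps(1) by (induction rule: spanning_tree.induct) auto
    obtain c1 where c1: "supp c1 \<subseteq> T" "margins c1 = margins (unit_array i l)"
      using col.IH[of i l] col.prems l by blast
    obtain c2 where c2: "supp c2 \<subseteq> T" "margins c2 = margins (unit_array i' l)"
      using col.IH[of i' l] col.hyps l by blast
    have "supp (unit_array i' j' + (c1 - c2)) \<subseteq> ?S"
      using c1(1) c2(1) by (intro supp_add_subset supp_diff_subset) (auto simp: supp_unit_array)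
    moreover have "margins (unit_array i' j' + (c1 - c2)) = margins (unit_array i j)"
      using c1(2) c2(2) True by (simp add: margins_add margins_diff margins_unit_array)
    ultimately show ?thesis by blast
  qed
qed

section \<open>Pairs of spanning trees with equal margins\<close>

definition tree_pair :: "'m::finite set \<Rightarrow> 'n::finite set \<Rightarrow> real^'n^'m \<Rightarrow> real^'n^'m \<Rightarrow> bool" where
  "tree_pair A B x y \<longleftrightarrow> (\<forall>i j. 0 \<le> x $ i $ j) \<and> (\<forall>i j. 0 \<le> y $ i $ j) \<and> margins x = margins y
     \<and> spanning_tree A B (supp x) \<and> spanning_tree A B (supp y)"

lemma supp_add_unit_array:
  assumes "\<And>i j. 0 \<le> x $ i $ j" "0 < s"
  shows "supp (x + s *\<^sub>R unit_array k l) = insert (k, l) (supp x)"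
proof -
  have "x $ k $ l + s \<noteq> 0"
    using assms by (metis add_nonneg_pos less_irrefl)
  then show ?thesis
    by (auto simp: supp_def unit_array_nth split: if_splits)
qed

text \<open>
  The new row is a leaf of both trees, attached to different columns \<open>j\<close> and \<open>j'\<close>;
  the path from \<open>j\<close> to \<open>j'\<close> in the first tree compensates for the difference.
\<close>

lemma tree_pair_add_row:
  assumes xy: "tree_pair A B x y" and i: "i \<notin> A" and j: "j \<in> B" "j' \<in> B" "j \<noteq> j'"
  shows "\<exists>x' y'. tree_pair (insert i A) B x' y'
    \<and> card (supp x' \<union> supp y') = card (supp x \<union> supp y) + 2"
proof -
  have nn: "\<And>i j. 0 \<le> x $ i $ j" "\<And>i j. 0 \<le> y $ i $ j" and eq: "margins x = margins y"
    and trees: "spanning_tree A B (supp x)" "spanning_tree A B (supp y)"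
    using xy by (auto simp: tree_pair_def)
  have sub: "supp x \<subseteq> A \<times> B" "supp y \<subseteq> A \<times> B"
    using trees by (auto dest: spanning_tree_subset)
  obtain k where k: "k \<in> A"
    using trees(1) by (induction rule: spanning_tree.induct) auto
  obtain c1 where c1: "supp c1 \<subseteq> supp x" "margins c1 = margins (unit_array k j')"
    using spanning_tree_path[OF trees(1) k j(2)] by blast
  obtain c2 where c2: "supp c2 \<subseteq> supp x" "margins c2 = margins (unit_array k j)"
    using spanning_tree_path[OF trees(1) k j(1)] by blast
  \<comment> \<open>The row margins of the two paths from \<open>k\<close> cancel: \<open>c\<close>
    moves one unit from column \<open>j\<close> to column \<open>j'\<close> along edges of
    \<open>supp x\<close>.\<close>
  define c where "c = c1 - c2"
  have c: "supp c \<subseteq> supp x"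
    using c1 c2 unfolding c_def by (intro supp_diff_subset)
  have "\<forall>\<^sub>F s in at_right 0. x $ k $ l \<noteq> 0 \<longrightarrow> 0 < x $ k $ l + s * c $ k $ l" for k l
  proof (cases "x $ k $ l = 0")
    case False
    have "((\<lambda>s. x $ k $ l + s * c $ k $ l) \<longlongrightarrow> x $ k $ l + 0 * c $ k $ l) (at_right 0)"
      by (intro tendsto_intros)
    then have "\<forall>\<^sub>F s in at_right 0. 0 < x $ k $ l + s * c $ k $ l"
      using nn(1)[of k l] False by (intro order_tendstoD(1)) auto
    then show ?thesis by eventually_elim simp
  qed simp
  then have "\<forall>\<^sub>F s in at_right 0. \<forall>k l. x $ k $ l \<noteq> 0 \<longrightarrow> 0 < x $ k $ l + s * c $ k $ l"
    by (intro eventually_all_finite) auto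
  moreover have "\<forall>\<^sub>F s in at_right (0::real). 0 < s"
    by (rule eventually_at_right_less)
  ultimately have "\<forall>\<^sub>F s in at_right 0. 0 < s
      \<and> (\<forall>k l. x $ k $ l \<noteq> 0 \<longrightarrow> 0 < x $ k $ l + s * c $ k $ l)"
    by eventually_elim simp
  then obtain s where s: "0 < s"
    and pos: "\<And>k l. x $ k $ l \<noteq> 0 \<Longrightarrow> 0 < x $ k $ l + s * c $ k $ l"
    using eventually_happens[of _ "at_right (0::real)"] by force
  define x0 where "x0 = x + s *\<^sub>R c"
  define x' where "x' = x0 + s *\<^sub>R unit_array i j"
  define y' where "y' = y + s *\<^sub>R unit_array i j'"
  have x0: "0 \<le> x0 $ k $ l \<and> (x0 $ k $ l = 0 \<longleftrightarrow> x $ k $ l = 0)" for k l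
    using pos[of k l] c by (cases "x $ k $ l = 0") (auto simp: x0_def supp_subset_iff)
  then have "supp x0 = supp x"
    by (auto simp: supp_def)
  then have supp: "supp x' = insert (i, j) (supp x)" "supp y' = insert (i, j') (supp y)"
    using x0 nn s by (simp_all add: x'_def y'_def supp_add_unit_array)
  have "tree_pair (insert i A) B x' y'"
    unfolding tree_pair_def
  proof (intro conjI allI)
    show "0 \<le> x' $ k $ l" "0 \<le> y' $ k $ l" for k l
      using x0[of k l] nn[of k l] s by (auto simp: x'_def y'_def unit_array_nth)
    show "margins x' = margins y'"
      unfolding x'_def y'_def x0_def c_def margins_add margins_diff margins_scaleR eq c1(2) c2(2)
      by (simp add: margins_unit_array scaleR_diff_right)
    show "spanning_tree (insert i A) B (supp x')" "spanning_tree (insert i A) B (supp y')"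
      unfolding supp using trees i j by (auto intro: spanning_tree.row)
  qed
  moreover have "card (supp x' \<union> supp y') = card (supp x \<union> supp y) + 2"
  proof -
    have "supp x' \<union> supp y' = insert (i, j) (insert (i, j') (supp x \<union> supp y))"
      unfolding supp by blast
    moreover have "(i, j) \<notin> supp x \<union> supp y" "(i, j') \<notin> supp x \<union> supp y"
      using sub i by blast+
    ultimately show ?thesis
      using j(3) by simp
  qed
  ultimately show ?thesis by blast
qed

lemma tree_pair_add_rows:
  fixes A D :: "'m::finite set"
  assumes "tree_pair A B x y" "D \<inter> A = {}" and j: "j \<in> B" "j' \<in> B" "j \<noteq> j'"
  shows "\<exists>x' y'. tree_pair (A \<union> D) B x' y'
    \<and> card (supp x' \<union> supp y') = card (supp x \<union> supp y) + 2 * card D"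
  using finite[of D] assms(2)
proof (induction D rule: finite_induct)
  case empty
  then show ?case using assms(1) by auto
next
  case (insert i D)
  then obtain x' y' where "tree_pair (A \<union> D) B x' y'"
    "card (supp x' \<union> supp y') = card (supp x \<union> supp y) + 2 * card D"
    by auto
  moreover have "i \<notin> A \<union> D"
    using insert by blast
  ultimately show ?case
    using tree_pair_add_row[of "A \<union> D" B x' y' i j j'] j insert.hyps by auto
qed

lemma supp_transpose: "supp (transpose x) = prod.swap ` supp x" for x :: "real^'n^'m"
  by (force simp: supp_def transpose_def)

lemma margins_transpose: "margins (transpose x) = prod.swap (margins x)"
  by (simp add: margins_def transpose_def)

lemma tree_pair_transpose:
  assumes "tree_pair A B x y"
  shows "tree_pair B A (transpose x) (transpose y)"
    "card (supp (transpose x) \<union> supp (transpose y)) = card (supp x \<union> supp y)"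
proof -
  show "tree_pair B A (transpose x) (transpose y)"
    using assms
    by (simp add: tree_pair_def supp_transpose margins_transpose spanning_tree_swap)
      (simp add: transpose_def)
  show "card (supp (transpose x) \<union> supp (transpose y)) = card (supp x \<union> supp y)"
    unfolding supp_transpose image_Un[symmetric] by (rule card_image) simp
qed

lemma tree_pair_add_cols:
  fixes B D :: "'n::finite set"
  assumes xy: "tree_pair A B x y" and "D \<inter> B = {}" and "i \<in> A" "i' \<in> A" "i \<noteq> i'"
  shows "\<exists>x' y'. tree_pair A (B \<union> D) x' y'
    \<and> card (supp x' \<union> supp y') = card (supp x \<union> supp y) + 2 * card D"
proof -
  obtain x' y' where "tree_pair (B \<union> D) A x' y'"
    "card (supp x' \<union> supp y') = card (supp x \<union> supp y) + 2 * card D"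
    using tree_pair_add_rows[OF tree_pair_transpose(1)[OF xy] assms(2-5)]
    unfolding tree_pair_transpose(2)[OF xy] by blast
  then show ?thesis
    using tree_pair_transpose by metis
qed

section \<open>Explicit tree pairs for 2 x 2, 3 x 3 and 3 x 4\<close>

lemma scaleR_3: "3 *\<^sub>R v = v + v + v" for v :: "'a::real_vector"
  using scaleR_left_distrib[of 2 1 v] by (simp add: scaleR_2)

text \<open>Base for arrays with two rows. Both arrays have row sums 2, 2 and column sums 1, 3, and
  together they use all four edges.\<close>

lemma tree_pair_2_2:
  fixes a1 a2 :: "'m::finite" and b1 b2 :: "'n::finite"
  assumes ne: "a1 \<noteq> a2" "b1 \<noteq> b2"
  shows "\<exists>x y. tree_pair {a1, a2} {b1, b2} x y \<and> card (supp x \<union> supp y) = 4"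
proof -
  let ?e = unit_array
  define x where "x = 1 *\<^sub>R ?e a1 b1 + 1 *\<^sub>R ?e a1 b2 + 2 *\<^sub>R ?e a2 b2"
  define y where "y = 2 *\<^sub>R ?e a1 b2 + 1 *\<^sub>R ?e a2 b2 + 1 *\<^sub>R ?e a2 b1"
  have nn: "0 \<le> x $ i $ j" "0 \<le> y $ i $ j" for i j
    by (simp_all add: x_def y_def unit_array_nonneg add_nonneg_nonneg)
  have x: "supp x = {(a2, b2), (a1, b2), (a1, b1)}"
    unfolding x_def
    by (simp add: supp_add_unit_array supp_scaleR_unit_array unit_array_nonneg add_nonneg_nonneg
        del: scaleR_one)
  have y: "supp y = {(a2, b1), (a2, b2), (a1, b2)}"
    unfolding y_def
    by (simp add: supp_add_unit_array supp_scaleR_unit_array unit_array_nonneg add_nonneg_nonneg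
        del: scaleR_one)
  have "spanning_tree {a1} {b1} {(a1, b1)}"
    by (rule single)
  then have "spanning_tree {a1} {b2, b1} {(a1, b2), (a1, b1)}"
    by (rule col) (use ne in auto)
  then have tx: "spanning_tree {a2, a1} {b2, b1} (supp x)"
    unfolding x by (rule row) (use ne in auto)
  have "spanning_tree {a1} {b2} {(a1, b2)}"
    by (rule single)
  then have "spanning_tree {a2, a1} {b2} {(a2, b2), (a1, b2)}"
    by (rule row) (use ne in auto)
  then have ty: "spanning_tree {a2, a1} {b1, b2} (supp y)"
    unfolding y by (rule col) (use ne in auto)
  \<comment> \<open>Coefficients 2 and 3 are unfolded into repeated sums, so both sides agree up to
    reordering of summands.\<close>
  have "margins x = margins y"
    by (simp only: x_def y_def margins_add margins_scaleR margins_unit_array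
        scaleR_one scaleR_2 scaleR_3 add_Pair ac_simps)
  then have "tree_pair {a1, a2} {b1, b2} x y"
    using nn tx ty by (simp add: tree_pair_def insert_commute)
  moreover have "card (supp x \<union> supp y) = 4"
    unfolding x y using ne by (auto simp: card_insert_if)
  ultimately show ?thesis by blast
qed

text \<open>Attaching leaves to the 2 x 2 pair would reach only 8 edges, but all 9 are wanted here.
  The two five-edge trees therefore share a single edge, \<open>(a2, b3)\<close>. Row sums are 3, 2,
  3 and column sums 2, 2, 4.\<close>

lemma tree_pair_3_3:
  fixes a1 a2 a3 :: "'m::finite" and b1 b2 b3 :: "'n::finite"
  assumes ne: "distinct [a1, a2, a3]" "distinct [b1, b2, b3]"
  shows "\<exists>x y. tree_pair {a1, a2, a3} {b1, b2, b3} x y \<and> card (supp x \<union> supp y) = 9"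
proof -
  let ?e = unit_array
  define x where "x = 2 *\<^sub>R ?e a1 b1 + 1 *\<^sub>R ?e a1 b2 + 1 *\<^sub>R ?e a2 b2 + 1 *\<^sub>R ?e a2 b3
    + 3 *\<^sub>R ?e a3 b3"
  define y where "y = 3 *\<^sub>R ?e a1 b3 + 1 *\<^sub>R ?e a2 b3 + 1 *\<^sub>R ?e a2 b1 + 1 *\<^sub>R ?e a3 b1
    + 2 *\<^sub>R ?e a3 b2"
  have nn: "0 \<le> x $ i $ j" "0 \<le> y $ i $ j" for i j
    by (simp_all add: x_def y_def unit_array_nonneg add_nonneg_nonneg)
  have x: "supp x = {(a3, b3), (a2, b3), (a2, b2), (a1, b2), (a1, b1)}"
    unfolding x_def
    by (simp add: supp_add_unit_array supp_scaleR_unit_array unit_array_nonneg add_nonneg_nonneg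
        del: scaleR_one)
  have y: "supp y = {(a3, b2), (a3, b1), (a2, b1), (a2, b3), (a1, b3)}"
    unfolding y_def
    by (simp add: supp_add_unit_array supp_scaleR_unit_array unit_array_nonneg add_nonneg_nonneg
        del: scaleR_one)
  have "spanning_tree {a1} {b1} {(a1, b1)}"
    by (rule single)
  then have "spanning_tree {a1} {b2, b1} {(a1, b2), (a1, b1)}"
    by (rule col) (use ne in auto)
  then have "spanning_tree {a2, a1} {b2, b1} {(a2, b2), (a1, b2), (a1, b1)}"
    by (rule row) (use ne in auto)
  then have "spanning_tree {a2, a1} {b3, b2, b1} {(a2, b3), (a2, b2), (a1, b2), (a1, b1)}"
    by (rule col) (use ne in auto)
  then have tx: "spanning_tree {a3, a2, a1} {b3, b2, b1} (supp x)"
    unfolding x by (rule row) (use ne in auto)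
  have "spanning_tree {a1} {b3} {(a1, b3)}"
    by (rule single)
  then have "spanning_tree {a2, a1} {b3} {(a2, b3), (a1, b3)}"
    by (rule row) (use ne in auto)
  then have "spanning_tree {a2, a1} {b1, b3} {(a2, b1), (a2, b3), (a1, b3)}"
    by (rule col) (use ne in auto)
  then have "spanning_tree {a3, a2, a1} {b1, b3} {(a3, b1), (a2, b1), (a2, b3), (a1, b3)}"
    by (rule row) (use ne in auto)
  then have ty: "spanning_tree {a3, a2, a1} {b2, b1, b3} (supp y)"
    unfolding y by (rule col) (use ne in auto)
  have "margins x = margins y"
    by (simp only: x_def y_def margins_add margins_scaleR margins_unit_array
        scaleR_one scaleR_2 scaleR_3 add_Pair ac_simps)
  then have "tree_pair {a1, a2, a3} {b1, b2, b3} x y"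
    using nn tx ty by (simp add: tree_pair_def insert_commute)
  moreover have "card (supp x \<union> supp y) = 9"
    unfolding x y using ne by (auto simp: card_insert_if)
  ultimately show ?thesis by blast
qed

text \<open>The two supports partition the \<open>12\<close> edges of \<open>K\<^sub>3\<^sub>,\<^sub>4\<close>.\<close>

lemma tree_pair_3_4:
  fixes a1 a2 a3 :: "'m::finite" and b1 b2 b3 b4 :: "'n::finite"
  assumes ne: "distinct [a1, a2, a3]" "distinct [b1, b2, b3, b4]"
  shows "\<exists>x y. tree_pair {a1, a2, a3} {b1, b2, b3, b4} x y \<and> card (supp x \<union> supp y) = 12"
proof -
  let ?e = unit_array
  \<comment> \<open>\<open>supp x\<close> is the path b3, a2, b1, a1, b2, a3, b4. Swapping column
    \<open>b1\<close> with \<open>b4\<close> and \<open>b2\<close> with \<open>b3\<close> turns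
    \<open>x\<close> into \<open>y\<close>; all column sums are 2, so the margins agree.\<close>
  define x where "x = 1 *\<^sub>R ?e a1 b1 + 1 *\<^sub>R ?e a1 b2 + 1 *\<^sub>R ?e a2 b1 + 2 *\<^sub>R ?e a2 b3
    + 1 *\<^sub>R ?e a3 b2 + 2 *\<^sub>R ?e a3 b4"
  define y where "y = 1 *\<^sub>R ?e a1 b3 + 1 *\<^sub>R ?e a1 b4 + 1 *\<^sub>R ?e a2 b4 + 2 *\<^sub>R ?e a2 b2
    + 1 *\<^sub>R ?e a3 b3 + 2 *\<^sub>R ?e a3 b1"
  have nn: "0 \<le> x $ i $ j" "0 \<le> y $ i $ j" for i j
    by (simp_all add: x_def y_def unit_array_nonneg add_nonneg_nonneg)
  have x: "supp x = {(a3, b4), (a3, b2), (a2, b3), (a2, b1), (a1, b2), (a1, b1)}"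
    unfolding x_def
    by (simp add: supp_add_unit_array supp_scaleR_unit_array unit_array_nonneg add_nonneg_nonneg
        del: scaleR_one)
  have y: "supp y = {(a3, b1), (a3, b3), (a2, b2), (a2, b4), (a1, b4), (a1, b3)}"
    unfolding y_def
    by (simp add: supp_add_unit_array supp_scaleR_unit_array unit_array_nonneg add_nonneg_nonneg
        del: scaleR_one)
  have "spanning_tree {a1} {b1} {(a1, b1)}"
    by (rule single)
  then have "spanning_tree {a1} {b2, b1} {(a1, b2), (a1, b1)}"
    by (rule col) (use ne in auto)
  then have "spanning_tree {a2, a1} {b2, b1} {(a2, b1), (a1, b2), (a1, b1)}"
    by (rule row) (use ne in auto)
  then have "spanning_tree {a2, a1} {b3, b2, b1} {(a2, b3), (a2, b1), (a1, b2), (a1, b1)}"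
    by (rule col) (use ne in auto)
  then have "spanning_tree {a3, a2, a1} {b3, b2, b1}
      {(a3, b2), (a2, b3), (a2, b1), (a1, b2), (a1, b1)}"
    by (rule row) (use ne in auto)
  then have tx: "spanning_tree {a3, a2, a1} {b4, b3, b2, b1} (supp x)"
    unfolding x by (rule col) (use ne in auto)
  have "spanning_tree {a1} {b3} {(a1, b3)}"
    by (rule single)
  then have "spanning_tree {a1} {b4, b3} {(a1, b4), (a1, b3)}"
    by (rule col) (use ne in auto)
  then have "spanning_tree {a2, a1} {b4, b3} {(a2, b4), (a1, b4), (a1, b3)}"
    by (rule row) (use ne in auto)
  then have "spanning_tree {a2, a1} {b2, b4, b3} {(a2, b2), (a2, b4), (a1, b4), (a1, b3)}"
    by (rule col) (use ne in auto)
  then have "spanning_tree {a3, a2, a1} {b2, b4, b3}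
      {(a3, b3), (a2, b2), (a2, b4), (a1, b4), (a1, b3)}"
    by (rule row) (use ne in auto)
  then have ty: "spanning_tree {a3, a2, a1} {b1, b2, b4, b3} (supp y)"
    unfolding y by (rule col) (use ne in auto)
  have "margins x = margins y"
    by (simp only: x_def y_def margins_add margins_scaleR margins_unit_array
        scaleR_one scaleR_2 scaleR_3 add_Pair ac_simps)
  then have "tree_pair {a1, a2, a3} {b1, b2, b3, b4} x y"
    using nn tx ty by (simp add: tree_pair_def insert_commute)
  moreover have "card (supp x \<union> supp y) = 12"
    unfolding x y using ne by (auto simp: card_insert_if)
  ultimately show ?thesis by blast
qed

section \<open>Tree pairs in all dimensions\<close>

lemma exists_notin_if_card_less:
  fixes S :: "'a::finite set"
  assumes "card S < CARD('a)"
  shows "\<exists>x. x \<notin> S"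
  using assms by (metis UNIV_eq_I less_irrefl)

lemma exists_2_distinct:
  assumes "2 \<le> CARD('a::finite)"
  shows "\<exists>a b :: 'a. a \<noteq> b"
proof -
  fix a :: 'a
  show ?thesis
    using exists_notin_if_card_less[of "{a}"] assms by auto
qed

lemma exists_3_distinct:
  assumes "3 \<le> CARD('a::finite)"
  shows "\<exists>a b c :: 'a. distinct [a, b, c]"
proof -
  obtain a b :: 'a where "a \<noteq> b"
    using exists_2_distinct[where 'a = 'a] assms by auto
  then show ?thesis
    using exists_notin_if_card_less[of "{a, b}"] assms by auto
qed

lemma exists_4_distinct:
  assumes "4 \<le> CARD('a::finite)"
  shows "\<exists>a b c d :: 'a. distinct [a, b, c, d]"
proof -
  obtain a b c :: 'a where abc: "distinct [a, b, c]"
    using exists_3_distinct[where 'a = 'a] assms by auto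
  then have "card {a, b, c} = 3"
    by auto
  then obtain d where "d \<notin> {a, b, c}"
    using exists_notin_if_card_less[of "{a, b, c}"] assms by auto
  then have "distinct [a, b, c, d]"
    using abc by auto
  then show ?thesis by blast
qed

lemma card_Compl_add: "card (- S) = CARD('a) - card S" for S :: "'a::finite set"
  by (simp add: Compl_eq_Diff_UNIV card_Diff_subset)

text \<open>An attached row or column adds two edges to the union, so the value 2 (m + n - 1)
  attained by the 3 x 4 pair persists. For m = 2 the growth of the 2 x 2 pair by columns keeps all 2
  n edges covered; 3 x 3 is sporadic.\<close>

lemma exists_tree_pair_if_le:
  assumes "2 \<le> CARD('m::finite)" "CARD('m) \<le> CARD('n::finite)"
  shows "\<exists>x y :: real^'n^'m. tree_pair UNIV UNIV x y
    \<and> min (CARD('m) * CARD('n)) (2 * (CARD('m) + CARD('n) - 1)) \<le> card (supp x \<union> supp y)"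
proof -
  consider "CARD('m) = 2" | "CARD('m) = 3" "CARD('n) = 3" | "3 \<le> CARD('m)" "4 \<le> CARD('n)"
    using assms by linarith
  then show ?thesis
  proof cases
    case 1
    obtain a1 a2 :: 'm where a: "a1 \<noteq> a2"
      using exists_2_distinct[where 'a = 'm] assms by auto
    obtain b1 b2 :: 'n where b: "b1 \<noteq> b2"
      using exists_2_distinct[where 'a = 'n] assms by auto
    have A: "{a1, a2} = UNIV"
      using a 1 by (intro card_eq_UNIV_imp_eq_UNIV) auto
    obtain x y where "tree_pair {a1, a2} {b1, b2} x y" "card (supp x \<union> supp y) = 4"
      using tree_pair_2_2[OF a b] by blast
    then obtain x' y' where xy: "tree_pair {a1, a2} ({b1, b2} \<union> - {b1, b2}) x' y'"
      "card (supp x' \<union> supp y') = 4 + 2 * card (- {b1, b2})"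
      using tree_pair_add_cols[of "{a1, a2}" "{b1, b2}" x y "- {b1, b2}" a1 a2] a by auto
    have "card {b1, b2} = 2" using b by simp
    then have "card (supp x' \<union> supp y') = 2 * CARD('n)"
      unfolding xy(2) card_Compl_add using assms by simp
    moreover have "tree_pair UNIV UNIV x' y'"
      using xy(1) A by simp
    ultimately show ?thesis
      using 1 by (metis min.cobounded1)
  next
    case 2
    obtain a1 a2 a3 :: 'm where a: "distinct [a1, a2, a3]"
      using exists_3_distinct[where 'a = 'm] 2 by auto
    obtain b1 b2 b3 :: 'n where b: "distinct [b1, b2, b3]"
      using exists_3_distinct[where 'a = 'n] 2 by auto
    have "{a1, a2, a3} = UNIV" "{b1, b2, b3} = UNIV"
      using a b 2 by (auto intro!: card_eq_UNIV_imp_eq_UNIV)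
    then obtain x y :: "real^'n^'m"
      where "tree_pair UNIV UNIV x y" "card (supp x \<union> supp y) = 9"
      using tree_pair_3_3[OF a b] by auto
    then show ?thesis
      using 2 by (intro exI[of _ x] exI[of _ y]) simp
  next
    case 3
    obtain a1 a2 a3 :: 'm where a: "distinct [a1, a2, a3]"
      using exists_3_distinct[where 'a = 'm] 3 by auto
    obtain b1 b2 b3 b4 :: 'n where b: "distinct [b1, b2, b3, b4]"
      using exists_4_distinct[where 'a = 'n] 3 by auto
    let ?A = "{a1, a2, a3}" and ?B = "{b1, b2, b3, b4}"
    obtain x y where "tree_pair ?A ?B x y" "card (supp x \<union> supp y) = 12"
      using tree_pair_3_4[OF a b] by blast
    then obtain x' y' where "tree_pair ?A (?B \<union> - ?B) x' y'"
      "card (supp x' \<union> supp y') = 12 + 2 * card (- ?B)"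
      using tree_pair_add_cols[of ?A ?B x y "- ?B" a1 a2] a by auto
    then obtain x'' y'' where xy: "tree_pair (?A \<union> - ?A) (?B \<union> - ?B) x'' y''"
      "card (supp x'' \<union> supp y'') = 12 + 2 * card (- ?B) + 2 * card (- ?A)"
      using tree_pair_add_rows[of ?A "?B \<union> - ?B" x' y' "- ?A" b1 b2] b by auto
    have "card ?A = 3" "card ?B = 4" using a b by auto
    then have "card (supp x'' \<union> supp y'') = 2 * (CARD('m) + CARD('n) - 1)"
      unfolding xy(2) card_Compl_add using 3 by simp
    moreover have "tree_pair UNIV UNIV x'' y''"
      using xy(1) by (simp only: Compl_partition)
    ultimately show ?thesis
      by (metis min.cobounded2)
  qed
qed

lemma exists_tree_pair:
  assumes "2 \<le> CARD('m::finite)" "2 \<le> CARD('n::finite)"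
  shows "\<exists>x y :: real^'n^'m. tree_pair UNIV UNIV x y
    \<and> min (CARD('m) * CARD('n)) (2 * (CARD('m) + CARD('n) - 1)) \<le> card (supp x \<union> supp y)"
proof (cases "CARD('m) \<le> CARD('n)")
  case True
  then show ?thesis
    using assms by (intro exists_tree_pair_if_le)
next
  case False
  then obtain x y :: "real^'m^'n" where xy: "tree_pair UNIV UNIV x y"
    "min (CARD('n) * CARD('m)) (2 * (CARD('n) + CARD('m) - 1)) \<le> card (supp x \<union> supp y)"
    using exists_tree_pair_if_le[where 'm = 'n and 'n = 'm] assms by auto
  then show ?thesis
    using tree_pair_transpose[OF xy(1)] by (metis add.commute mult.commute)
qed

section \<open>Lower bound and conclusion\<close>

lemma exists_large_circuit_diameter:
  "\<exists>(u :: real^'m) (v :: real^'n). (\<forall>i. 0 < u $ i) \<and> (\<forall>j. 0 < v $ j)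
     \<and> (\<Sum>i\<in>UNIV. u $ i) = (\<Sum>j\<in>UNIV. v $ j)
     \<and> enat (min ((CARD('m) - 1) * (CARD('n) - 1)) (CARD('m) + CARD('n) - 1))
         \<le> circuit_diameter (transportation_polytope u v)"
proof (cases "2 \<le> CARD('m) \<and> 2 \<le> CARD('n)")
  case False
  then have "enat (min ((CARD('m) - 1) * (CARD('n) - 1)) (CARD('m) + CARD('n) - 1)) = 0"
    by (auto simp: zero_enat_def)
  \<comment> \<open>The bound is 0 here, so any positive margins of equal total will do; constant
    entries give total m n on both sides.\<close>
  then show ?thesis
    by (intro exI[of _ "(\<chi> i. real CARD('n)) :: real^'m"]
          exI[of _ "(\<chi> j. real CARD('m)) :: real^'n"])
      (simp del: One_nat_def)
next
  case True
  let ?m = "CARD('m)" and ?n = "CARD('n)"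
  obtain x y :: "real^'n^'m" where xy: "tree_pair UNIV UNIV x y"
    "min (?m * ?n) (2 * (?m + ?n - 1)) \<le> card (supp x \<union> supp y)"
    using exists_tree_pair[where 'm = 'm and 'n = 'n] True by blast
  have trees: "spanning_tree UNIV UNIV (supp x)" "spanning_tree UNIV UNIV (supp y)"
    using xy(1) by (auto simp: tree_pair_def)
  \<comment> \<open>Subtracting the rank bound m + n - 1 from the size of the union thus yields
    exactly the two terms of the claimed minimum.\<close>
  have "(?m - 1) * (?n - 1) + (?m + ?n - 1) = ?m * ?n"
    using True by (cases ?m; cases ?n) auto
  then have "min ((?m - 1) * (?n - 1)) (?m + ?n - 1) \<le> dim (kernel_on (supp x \<union> supp y))"
    using xy(2) card_le_dim_kernel_on[of "supp x \<union> supp y"] by linarith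
  moreover have "\<exists>(u :: real^'m) (v :: real^'n). (\<forall>i. 0 < u $ i) \<and> (\<forall>j. 0 < v $ j)
      \<and> (\<Sum>i\<in>UNIV. u $ i) = (\<Sum>j\<in>UNIV. v $ j)
      \<and> enat (dim (kernel_on (supp x \<union> supp y))) \<le> circuit_diameter (transportation_polytope u v)"
  proof (rule exists_generic_vertex_pair)
    show "\<exists>j. x $ i $ j \<noteq> 0" for i
      using spanning_tree_covers_rows[OF trees(1), of i] by simp
    show "\<exists>i. x $ i $ j \<noteq> 0" for j
      using spanning_tree_covers_cols[OF trees(1), of j] by simp
    show "forest (supp x)" "forest (supp y)"
      using trees by (auto intro: forest_if_spanning_tree)
  qed (use xy(1) in \<open>auto simp: tree_pair_def\<close>)
  ultimately show ?thesis
    by (meson enat_ord_simps(1) order_trans)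
qed

lemma min_product_sum_eq:
  fixes m n :: nat
  assumes "3 \<le> m" "4 \<le> n"
  shows "min ((m - 1) * (n - 1)) (m + n - 1) = m + n - 1"
proof -
  \<comment> \<open>The shift removes truncated subtraction: (a + 2) (b + 3) is at least a + b + 6,
    with equality for the 3 x 4 case.\<close>
  obtain a b where "m = a + 3" "n = b + 4"
    using assms by (metis add.commute le_Suc_ex)
  then show ?thesis
    by (simp add: algebra_simps)
qed

theorem theorem1:
  shows
    "(\<exists>(u :: real^'m) (v :: real^'n). (\<forall>i. 0 < u $ i) \<and> (\<forall>j. 0 < v $ j)
        \<and> (\<Sum>i\<in>UNIV. u $ i) = (\<Sum>j\<in>UNIV. v $ j)
        \<and> circuit_diameter (transportation_polytope u v)
            \<ge> enat (min ((CARD('m) - 1) * (CARD('n) - 1)) (CARD('m) + CARD('n) - 1)))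
     \<and> (\<forall>(u :: real^'m) (v :: real^'n). (\<forall>i. 0 < u $ i) \<and> (\<forall>j. 0 < v $ j)
        \<longrightarrow> feasible_circuit_diameter (transportation_polytope u v)
              \<le> enat (CARD('m) + CARD('n) - 1))
     \<and> (CARD('m) \<ge> 3 \<and> CARD('n) \<ge> 4 \<longrightarrow>
         (\<exists>(u :: real^'m) (v :: real^'n). (\<forall>i. 0 < u $ i) \<and> (\<forall>j. 0 < v $ j)
            \<and> (\<Sum>i\<in>UNIV. u $ i) = (\<Sum>j\<in>UNIV. v $ j)
            \<and> circuit_diameter (transportation_polytope u v)
                = enat (CARD('m) + CARD('n) - 1)
            \<and> feasible_circuit_diameter (transportation_polytope u v)
                = enat (CARD('m) + CARD('n) - 1)))"
proof (intro conjI impI allI)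
  let ?m = "CARD('m)" and ?n = "CARD('n)"
  obtain u :: "real^'m" and v :: "real^'n"
    where uv: "\<forall>i. 0 < u $ i" "\<forall>j. 0 < v $ j" "(\<Sum>i\<in>UNIV. u $ i) = (\<Sum>j\<in>UNIV. v $ j)"
      and large: "enat (min ((?m - 1) * (?n - 1)) (?m + ?n - 1))
        \<le> circuit_diameter (transportation_polytope u v)"
    using exists_large_circuit_diameter[where 'm = 'm and 'n = 'n] by blast
  then show "\<exists>(u :: real^'m) (v :: real^'n). (\<forall>i. 0 < u $ i) \<and> (\<forall>j. 0 < v $ j)
        \<and> (\<Sum>i\<in>UNIV. u $ i) = (\<Sum>j\<in>UNIV. v $ j)
        \<and> enat (min ((?m - 1) * (?n - 1)) (?m + ?n - 1))
            \<le> circuit_diameter (transportation_polytope u v)"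
    by blast
  show "feasible_circuit_diameter (transportation_polytope u v) \<le> enat (?m + ?n - 1)"
    for u :: "real^'m" and v :: "real^'n"
    by (rule feasible_circuit_diameter_le)
  assume "3 \<le> ?m \<and> 4 \<le> ?n"
  then have "enat (?m + ?n - 1) \<le> circuit_diameter (transportation_polytope u v)"
    using large min_product_sum_eq[of ?m ?n] by simp
  \<comment> \<open>Both diameters are squeezed between the lower bound for the unrestricted one and
    the upper bound for the feasible one.\<close>
  then have "circuit_diameter (transportation_polytope u v) = enat (?m + ?n - 1)"
    "feasible_circuit_diameter (transportation_polytope u v) = enat (?m + ?n - 1)"
    using circuit_diameter_le_feasible[of "transportation_polytope u v"]
      feasible_circuit_diameter_le[of u v] by (meson antisym order_trans)+
  with uv show "\<exists>(u :: real^'m) (v :: real^'n). (\<forall>i. 0 < u $ i) \<and> (\<forall>j. 0 < v $ j)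
            \<and> (\<Sum>i\<in>UNIV. u $ i) = (\<Sum>j\<in>UNIV. v $ j)
            \<and> circuit_diameter (transportation_polytope u v) = enat (?m + ?n - 1)
            \<and> feasible_circuit_diameter (transportation_polytope u v) = enat (?m + ?n - 1)"
    by blast
qed

end
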